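(* For every $n\in\mathbb{N}$, the Plactic monoid $M_n$ of rank $n$ is of type right and left $\mathrm{FP}_\infty$.
   Context: Let $n \in \mathbb{N}=\{1,2,\ldots\}$ and let $A = \{1<2<\cdots<n\}$. The Plactic monoid $M_n$ is the monoid presented by $\langle A \mid \mathcal{R}\rangle$, where $\mathcal{R} = \{(xzy,zxy) : x \le y < z\} \cup \{(yxz,yzx) : x<y\le z\}$ with $x,y,z\in A$. A monoid $M$ is of type left (respectively right) $\mathrm{FP}_\infty$ if the trivial left (respectively right) $\mathbb{Z}M$-module $\mathbb{Z}$, on which every element of $M$ acts as the identity, has a resolution by finitely generated free left (respectively right) $\mathbb{Z}M$-modules. *)

theory Defs
  imports "HOL-Algebra.Module" "HOL-Algebra.AbelCoset" "HOL-Library.Poly_Mapping"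
begin

section \<open>Monoid presentations and the Plactic monoid\<close>

inductive_set pres_cong :: "'a set \<Rightarrow> ('a list \<times> 'a list) set \<Rightarrow> ('a list \<times> 'a list) set"
  for A :: "'a set" and R :: "('a list \<times> 'a list) set"
where
  gen: "(u, v) \<in> R \<Longrightarrow> (u, v) \<in> pres_cong A R"
| refl: "w \<in> lists A \<Longrightarrow> (w, w) \<in> pres_cong A R"
| sym: "(u, v) \<in> pres_cong A R \<Longrightarrow> (v, u) \<in> pres_cong A R"
| trans: "(u, v) \<in> pres_cong A R \<Longrightarrow> (v, w) \<in> pres_cong A R \<Longrightarrow> (u, w) \<in> pres_cong A R"
| mult: "(u, v) \<in> pres_cong A R \<Longrightarrow> (u', v') \<in> pres_cong A R \<Longrightarrow> (u @ u', v @ v') \<in> pres_cong A R"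

text \<open>The monoid presented by \<open>\<langle>A | R\<rangle>\<close>, for \<open>R \<subseteq> lists A \<times> lists A\<close>.\<close>

definition presented_monoid :: "'a set \<Rightarrow> ('a list \<times> 'a list) set \<Rightarrow> 'a list set monoid" where
  "presented_monoid A R =
    \<lparr>carrier = lists A // pres_cong A R,
     mult = (\<lambda>X Y. \<Union>u\<in>X. \<Union>v\<in>Y. pres_cong A R `` {u @ v}),
     one = pres_cong A R `` {[]}\<rparr>"

definition plactic_rels :: "nat \<Rightarrow> (nat list \<times> nat list) set" where
  "plactic_rels n =
    {([x, z, y], [z, x, y]) | x y z. {x, y, z} \<subseteq> {1..n} \<and> x \<le> y \<and> y < z} \<union>
    {([y, x, z], [y, z, x]) | x y z. {x, y, z} \<subseteq> {1..n} \<and> x < y \<and> y \<le> z}"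

definition plactic_monoid :: "nat \<Rightarrow> nat list set monoid" where
  "plactic_monoid n = presented_monoid {1..n} (plactic_rels n)"

lemma pres_cong_lists:
  assumes "R \<subseteq> lists A \<times> lists A" "(u, v) \<in> pres_cong A R"
  shows "u \<in> lists A \<and> v \<in> lists A"
  using assms(2)
proof induction
  case (gen u v)
  then show ?case using assms(1) by blast
qed auto

lemma equiv_pres_cong:
  assumes "R \<subseteq> lists A \<times> lists A"
  shows "equiv (lists A) (pres_cong A R)"
proof (rule equivI)
  show "pres_cong A R \<subseteq> lists A \<times> lists A"
    using pres_cong_lists[OF assms] by auto
  show "refl_on (lists A) (pres_cong A R)"
    by (rule refl_onI) (simp add: pres_cong.refl)
  show "sym (pres_cong A R)"
    by (rule symI) (rule pres_cong.sym)
  show "trans (pres_cong A R)"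
    by (rule transI) (rule pres_cong.trans)
qed

lemma presented_monoid_mult_class:
  assumes "R \<subseteq> lists A \<times> lists A" "u \<in> lists A" "v \<in> lists A"
  shows "pres_cong A R `` {u} \<otimes>\<^bsub>presented_monoid A R\<^esub> pres_cong A R `` {v} = pres_cong A R `` {u @ v}"
proof -
  have "congruent2 (pres_cong A R) (pres_cong A R) (\<lambda>u v. pres_cong A R `` {u @ v})"
    by (auto simp: congruent2_def intro!: equiv_class_eq[OF equiv_pres_cong[OF assms(1)]]
        intro: pres_cong.mult)
  from UN_equiv_class2[OF equiv_pres_cong[OF assms(1)] equiv_pres_cong[OF assms(1)] this assms(2,3)]
  show ?thesis by (simp add: presented_monoid_def)
qed

lemma monoid_presented_monoid:
  assumes "R \<subseteq> lists A \<times> lists A"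
  shows "monoid (presented_monoid A R)"
proof -
  let ?M = "presented_monoid A R"
  have c: "carrier ?M = lists A // pres_cong A R" and o: "\<one>\<^bsub>?M\<^esub> = pres_cong A R `` {[]}"
    by (simp_all add: presented_monoid_def)
  have ex: "\<exists>u\<in>lists A. X = pres_cong A R `` {u}" if "X \<in> carrier ?M" for X
    using that unfolding c quotient_def by blast
  have cl: "pres_cong A R `` {u} \<in> carrier ?M" if "u \<in> lists A" for u
    using that unfolding c by (rule quotientI)
  note m = presented_monoid_mult_class[OF assms]
  have app: "u @ v \<in> lists A" if "u \<in> lists A" "v \<in> lists A" for u v :: "'a list"
    using that by auto
  show ?thesis
  proof (rule monoidI)
    fix X Y assume "X \<in> carrier ?M" "Y \<in> carrier ?M"
    then obtain u v where "u \<in> lists A" "v \<in> lists A"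
      "X = pres_cong A R `` {u}" "Y = pres_cong A R `` {v}" using ex by meson
    then show "X \<otimes>\<^bsub>?M\<^esub> Y \<in> carrier ?M" using m cl app by metis
  next
    show "\<one>\<^bsub>?M\<^esub> \<in> carrier ?M" unfolding o by (rule cl) simp
  next
    fix X Y Z assume "X \<in> carrier ?M" "Y \<in> carrier ?M" "Z \<in> carrier ?M"
    then obtain u v w where "u \<in> lists A" "v \<in> lists A" "w \<in> lists A"
      "X = pres_cong A R `` {u}" "Y = pres_cong A R `` {v}" "Z = pres_cong A R `` {w}"
      using ex by meson
    then show "X \<otimes>\<^bsub>?M\<^esub> Y \<otimes>\<^bsub>?M\<^esub> Z = X \<otimes>\<^bsub>?M\<^esub> (Y \<otimes>\<^bsub>?M\<^esub> Z)"
      using m app by (simp del: in_lists_conv_set append_in_lists_conv)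
  next
    fix X assume "X \<in> carrier ?M"
    then obtain u where "u \<in> lists A" "X = pres_cong A R `` {u}" using ex by meson
    then show "\<one>\<^bsub>?M\<^esub> \<otimes>\<^bsub>?M\<^esub> X = X" and "X \<otimes>\<^bsub>?M\<^esub> \<one>\<^bsub>?M\<^esub> = X"
      using m[of "[]" u] m[of u "[]"] by (auto simp: o)
  qed
qed

lemma plactic_rels_lists: "plactic_rels n \<subseteq> lists {1..n} \<times> lists {1..n}"
  by (auto simp: plactic_rels_def)

lemma monoid_plactic_monoid: "monoid (plactic_monoid n)"
  unfolding plactic_monoid_def by (rule monoid_presented_monoid[OF plactic_rels_lists])


section \<open>The integral monoid ring\<close>

text \<open>Elements are finitely supported functions \<open>M \<rightarrow> \<int>\<close>; multiplication is the
  \<open>\<int>\<close>-bilinear extension of the multiplication of \<open>M\<close>.\<close>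

definition monoid_ring :: "('a, 'm) monoid_scheme \<Rightarrow> ('a \<Rightarrow>\<^sub>0 int) ring" where
  "monoid_ring M =
    \<lparr>carrier = {f. Poly_Mapping.keys f \<subseteq> carrier M},
     mult = (\<lambda>f g. frag_extend (\<lambda>x. frag_extend (\<lambda>y. frag_of (x \<otimes>\<^bsub>M\<^esub> y)) g) f),
     one = frag_of \<one>\<^bsub>M\<^esub>,
     zero = 0,
     add = (+)\<rparr>"

definition augmentation :: "('a \<Rightarrow>\<^sub>0 int) \<Rightarrow> int" where
  "augmentation f = (\<Sum>x\<in>Poly_Mapping.keys f. Poly_Mapping.lookup f x)"

lemma frag_extend_pointwise_diff:
  "frag_extend (\<lambda>x. f x - g x) c = frag_extend f c - frag_extend g c"
  using subset_UNIV
  by (induction c rule: frag_induction) (simp_all add: frag_extend_diff)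

lemma frag_extend_pointwise_add:
  "frag_extend (\<lambda>x. f x + g x) c = frag_extend f c + frag_extend g c"
  using subset_UNIV
  by (induction c rule: frag_induction) (simp_all add: frag_extend_diff)

lemma frag_extend_pointwise_zero: "frag_extend (\<lambda>x. 0) c = 0"
  by (rule frag_extend_eq_0) simp

lemma monoid_ring_sel:
  "carrier (monoid_ring M) = {f. Poly_Mapping.keys f \<subseteq> carrier M}"
  "\<one>\<^bsub>monoid_ring M\<^esub> = frag_of \<one>\<^bsub>M\<^esub>"
  "\<zero>\<^bsub>monoid_ring M\<^esub> = 0"
  "f \<oplus>\<^bsub>monoid_ring M\<^esub> g = f + g"
  by (simp_all add: monoid_ring_def)

lemma monoid_ring_mult:
  "frag_of x \<otimes>\<^bsub>monoid_ring M\<^esub> frag_of y = frag_of (x \<otimes>\<^bsub>M\<^esub> y)"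
  "(f + f') \<otimes>\<^bsub>monoid_ring M\<^esub> g = f \<otimes>\<^bsub>monoid_ring M\<^esub> g + f' \<otimes>\<^bsub>monoid_ring M\<^esub> g"
  "(f - f') \<otimes>\<^bsub>monoid_ring M\<^esub> g = f \<otimes>\<^bsub>monoid_ring M\<^esub> g - f' \<otimes>\<^bsub>monoid_ring M\<^esub> g"
  "f \<otimes>\<^bsub>monoid_ring M\<^esub> (g + g') = f \<otimes>\<^bsub>monoid_ring M\<^esub> g + f \<otimes>\<^bsub>monoid_ring M\<^esub> g'"
  "f \<otimes>\<^bsub>monoid_ring M\<^esub> (g - g') = f \<otimes>\<^bsub>monoid_ring M\<^esub> g - f \<otimes>\<^bsub>monoid_ring M\<^esub> g'"
  "0 \<otimes>\<^bsub>monoid_ring M\<^esub> g = 0"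
  "f \<otimes>\<^bsub>monoid_ring M\<^esub> 0 = 0"
  by (simp_all add: monoid_ring_def frag_extend_diff frag_extend_add frag_extend_pointwise_diff
      frag_extend_pointwise_add frag_extend_pointwise_zero)

lemma keys_monoid_ring_mult:
  assumes "monoid M" "Poly_Mapping.keys f \<subseteq> carrier M" "Poly_Mapping.keys g \<subseteq> carrier M"
  shows "Poly_Mapping.keys (f \<otimes>\<^bsub>monoid_ring M\<^esub> g) \<subseteq> carrier M"
proof -
  interpret monoid M by fact
  have "Poly_Mapping.keys (frag_extend (\<lambda>y. frag_of (x \<otimes>\<^bsub>M\<^esub> y)) g) \<subseteq> carrier M"
    if "x \<in> carrier M" for x
    by (rule order_trans[OF keys_frag_extend]) (use that assms(3) in auto)
  then show ?thesis
    unfolding monoid_ring_def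
    by simp (rule order_trans[OF keys_frag_extend], use assms(2) in blast)
qed

lemma monoid_ring_mult_assoc:
  assumes "monoid M" "Poly_Mapping.keys f \<subseteq> carrier M" "Poly_Mapping.keys g \<subseteq> carrier M"
    "Poly_Mapping.keys h \<subseteq> carrier M"
  shows "f \<otimes>\<^bsub>monoid_ring M\<^esub> g \<otimes>\<^bsub>monoid_ring M\<^esub> h = f \<otimes>\<^bsub>monoid_ring M\<^esub> (g \<otimes>\<^bsub>monoid_ring M\<^esub> h)"
proof -
  interpret monoid M by fact
  have 1: "frag_of x \<otimes>\<^bsub>monoid_ring M\<^esub> frag_of y \<otimes>\<^bsub>monoid_ring M\<^esub> h
      = frag_of x \<otimes>\<^bsub>monoid_ring M\<^esub> (frag_of y \<otimes>\<^bsub>monoid_ring M\<^esub> h)"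
    if "x \<in> carrier M" "y \<in> carrier M" for x y
    using assms(4)
    by (induction h rule: frag_induction) (simp_all add: monoid_ring_mult that m_assoc)
  have 2: "frag_of x \<otimes>\<^bsub>monoid_ring M\<^esub> g \<otimes>\<^bsub>monoid_ring M\<^esub> h
      = frag_of x \<otimes>\<^bsub>monoid_ring M\<^esub> (g \<otimes>\<^bsub>monoid_ring M\<^esub> h)"
    if "x \<in> carrier M" for x
    using assms(3) by (induction g rule: frag_induction) (simp_all add: monoid_ring_mult(2-) that 1)
  show ?thesis
    using assms(2) by (induction f rule: frag_induction) (simp_all add: monoid_ring_mult(2-) 2)
qed

lemma ring_monoid_ring:
  assumes "monoid M"
  shows "ring (monoid_ring M)"
proof (rule ringI)
  interpret M: monoid M by fact
  have neg: "\<exists>y\<in>carrier (monoid_ring M). y \<oplus>\<^bsub>monoid_ring M\<^esub> x = \<zero>\<^bsub>monoid_ring M\<^esub>"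
    if "x \<in> carrier (monoid_ring M)" for x
    using that by (intro bexI[of _ "- x"]) (auto simp: monoid_ring_sel)
  have ad: "Poly_Mapping.keys (x + y) \<subseteq> carrier M"
    if "Poly_Mapping.keys x \<subseteq> carrier M" "Poly_Mapping.keys y \<subseteq> carrier M" for x y :: "'a \<Rightarrow>\<^sub>0 int"
    using keys_add[of x y] that by blast
  show "abelian_group (monoid_ring M)"
    by (rule abelian_groupI) (use neg ad in \<open>auto simp: monoid_ring_sel ac_simps\<close>)
  have one: "frag_of \<one>\<^bsub>M\<^esub> \<otimes>\<^bsub>monoid_ring M\<^esub> x = x \<and> x \<otimes>\<^bsub>monoid_ring M\<^esub> frag_of \<one>\<^bsub>M\<^esub> = x"
    if "Poly_Mapping.keys x \<subseteq> carrier M" for x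
    using that by (induction x rule: frag_induction) (simp_all add: monoid_ring_mult)
  show "Group.monoid (monoid_ring M)"
    by (rule monoidI) (use keys_monoid_ring_mult[OF assms] monoid_ring_mult_assoc[OF assms] one
        in \<open>auto simp: monoid_ring_sel\<close>)
qed (simp_all add: monoid_ring_sel monoid_ring_mult)


section \<open>Modules over a not necessarily commutative ring\<close>

locale left_module = R?: ring R + M?: abelian_group M
  for R :: "('r, 'm) ring_scheme" and M :: "('r, 'a, 'n) module_scheme" +
  assumes smult_closed:
      "\<lbrakk>a \<in> carrier R; x \<in> carrier M\<rbrakk> \<Longrightarrow> a \<odot>\<^bsub>M\<^esub> x \<in> carrier M"
    and smult_l_distr:
      "\<lbrakk>a \<in> carrier R; b \<in> carrier R; x \<in> carrier M\<rbrakk> \<Longrightarrow>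
        (a \<oplus>\<^bsub>R\<^esub> b) \<odot>\<^bsub>M\<^esub> x = a \<odot>\<^bsub>M\<^esub> x \<oplus>\<^bsub>M\<^esub> b \<odot>\<^bsub>M\<^esub> x"
    and smult_r_distr:
      "\<lbrakk>a \<in> carrier R; x \<in> carrier M; y \<in> carrier M\<rbrakk> \<Longrightarrow>
        a \<odot>\<^bsub>M\<^esub> (x \<oplus>\<^bsub>M\<^esub> y) = a \<odot>\<^bsub>M\<^esub> x \<oplus>\<^bsub>M\<^esub> a \<odot>\<^bsub>M\<^esub> y"
    and smult_assoc:
      "\<lbrakk>a \<in> carrier R; b \<in> carrier R; x \<in> carrier M\<rbrakk> \<Longrightarrow>
        (a \<otimes>\<^bsub>R\<^esub> b) \<odot>\<^bsub>M\<^esub> x = a \<odot>\<^bsub>M\<^esub> (b \<odot>\<^bsub>M\<^esub> x)"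
    and smult_one:
      "x \<in> carrier M \<Longrightarrow> \<one>\<^bsub>R\<^esub> \<odot>\<^bsub>M\<^esub> x = x"

text \<open>In a right module \<open>a \<odot>\<^bsub>M\<^esub> x\<close> stands for \<open>x\<cdot>a\<close>, so that \<open>x\<cdot>(ab) = (x\<cdot>a)\<cdot>b\<close> is the
  reversed associativity law; this is the only axiom that differs from \<open>left_module\<close>.\<close>

locale right_module = R?: ring R + M?: abelian_group M
  for R :: "('r, 'm) ring_scheme" and M :: "('r, 'a, 'n) module_scheme" +
  assumes smult_closed:
      "\<lbrakk>a \<in> carrier R; x \<in> carrier M\<rbrakk> \<Longrightarrow> a \<odot>\<^bsub>M\<^esub> x \<in> carrier M"
    and smult_l_distr:
      "\<lbrakk>a \<in> carrier R; b \<in> carrier R; x \<in> carrier M\<rbrakk> \<Longrightarrow>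
        (a \<oplus>\<^bsub>R\<^esub> b) \<odot>\<^bsub>M\<^esub> x = a \<odot>\<^bsub>M\<^esub> x \<oplus>\<^bsub>M\<^esub> b \<odot>\<^bsub>M\<^esub> x"
    and smult_r_distr:
      "\<lbrakk>a \<in> carrier R; x \<in> carrier M; y \<in> carrier M\<rbrakk> \<Longrightarrow>
        a \<odot>\<^bsub>M\<^esub> (x \<oplus>\<^bsub>M\<^esub> y) = a \<odot>\<^bsub>M\<^esub> x \<oplus>\<^bsub>M\<^esub> a \<odot>\<^bsub>M\<^esub> y"
    and smult_assoc:
      "\<lbrakk>a \<in> carrier R; b \<in> carrier R; x \<in> carrier M\<rbrakk> \<Longrightarrow>
        (a \<otimes>\<^bsub>R\<^esub> b) \<odot>\<^bsub>M\<^esub> x = b \<odot>\<^bsub>M\<^esub> (a \<odot>\<^bsub>M\<^esub> x)"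
    and smult_one:
      "x \<in> carrier M \<Longrightarrow> \<one>\<^bsub>R\<^esub> \<odot>\<^bsub>M\<^esub> x = x"

text \<open>The following notions read the same for left and for right modules.\<close>

definition module_hom ::
  "('r, 'm) ring_scheme \<Rightarrow> ('r, 'a, 'n) module_scheme \<Rightarrow> ('r, 'b, 'k) module_scheme \<Rightarrow> ('a \<Rightarrow> 'b) set"
where
  "module_hom R M N =
    {h \<in> carrier M \<rightarrow> carrier N.
      (\<forall>x\<in>carrier M. \<forall>y\<in>carrier M. h (x \<oplus>\<^bsub>M\<^esub> y) = h x \<oplus>\<^bsub>N\<^esub> h y) \<and>
      (\<forall>a\<in>carrier R. \<forall>x\<in>carrier M. h (a \<odot>\<^bsub>M\<^esub> x) = a \<odot>\<^bsub>N\<^esub> h x)}"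

definition module_basis ::
  "('r, 'm) ring_scheme \<Rightarrow> ('r, 'a, 'n) module_scheme \<Rightarrow> 'a set \<Rightarrow> bool"
where
  "module_basis R M B \<longleftrightarrow> finite B \<and> B \<subseteq> carrier M \<and>
    (\<forall>x\<in>carrier M. \<exists>!c. c \<in> B \<rightarrow>\<^sub>E carrier R \<and> x = (\<Oplus>\<^bsub>M\<^esub>b\<in>B. c b \<odot>\<^bsub>M\<^esub> b))"

definition fg_free :: "('r, 'm) ring_scheme \<Rightarrow> ('r, 'a, 'n) module_scheme \<Rightarrow> bool" where
  "fg_free R M \<longleftrightarrow> (\<exists>B. module_basis R M B)"

text \<open>\<open>\<cdots> \<rightarrow> F 2 \<rightarrow> F 1 \<rightarrow> F 0 \<rightarrow> N \<rightarrow> 0\<close> is exact, where \<open>d i : F (i + 1) \<rightarrow> F i\<close> and \<open>e : F 0 \<rightarrow> N\<close>.\<close>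

definition fg_free_resolution ::
  "('r, 'm) ring_scheme \<Rightarrow> (nat \<Rightarrow> ('r, 'a, 'n) module_scheme) \<Rightarrow> (nat \<Rightarrow> 'a \<Rightarrow> 'a) \<Rightarrow>
    ('a \<Rightarrow> 'b) \<Rightarrow> ('r, 'b, 'k) module_scheme \<Rightarrow> bool"
where
  "fg_free_resolution R F d e N \<longleftrightarrow>
    (\<forall>i. fg_free R (F i)) \<and>
    (\<forall>i. d i \<in> module_hom R (F (Suc i)) (F i)) \<and>
    e \<in> module_hom R (F 0) N \<and>
    e ` carrier (F 0) = carrier N \<and>
    d 0 ` carrier (F 1) = a_kernel (F 0) N e \<and>
    (\<forall>i. d (Suc i) ` carrier (F (Suc (Suc i))) = a_kernel (F (Suc i)) (F i) (d i))"


section \<open>The trivial module and type $FP_\infty$\<close>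

text \<open>The group \<open>\<int>\<close>, on which every element of the monoid acts as the identity; extending
  additively, an element of the monoid ring acts as multiplication by its augmentation.
  It is both a left and a right module. Its \<open>mult\<close> and \<open>one\<close> fields play no role.\<close>

definition trivial_module :: "('a \<Rightarrow>\<^sub>0 int, int) module" where
  "trivial_module =
    \<lparr>carrier = UNIV, mult = (*), one = 1, zero = 0, add = (+),
     smult = (\<lambda>f k. augmentation f * k)\<rparr>"

lemma augmentation_frag_of: "augmentation (frag_of x) = 1"
  by (simp add: augmentation_def)

lemma augmentation_add: "augmentation (f + g) = augmentation f + augmentation g"
proof -
  let ?S = "Poly_Mapping.keys f \<union> Poly_Mapping.keys g"
  have *: "augmentation h = (\<Sum>x\<in>?S. Poly_Mapping.lookup h x)"
    if "Poly_Mapping.keys h \<subseteq> ?S" for h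
    unfolding augmentation_def using that
    by (intro sum.mono_neutral_left) (auto simp: in_keys_iff)
  show ?thesis
    using *[of f] *[of g] *[of "f + g"] keys_add[of f g] by (simp add: lookup_add sum.distrib)
qed

lemma augmentation_diff: "augmentation (f - g) = augmentation f - augmentation g"
  using augmentation_add[of "f - g" g] by simp

lemma augmentation_mult:
  "augmentation (f \<otimes>\<^bsub>monoid_ring M\<^esub> g) = augmentation f * augmentation g"
proof -
  have z: "augmentation 0 = 0" by (simp add: augmentation_def)
  have "augmentation (frag_of x \<otimes>\<^bsub>monoid_ring M\<^esub> g) = augmentation g" for x
    using subset_UNIV
    by (induction g rule: frag_induction)
      (simp_all add: z monoid_ring_mult augmentation_diff augmentation_frag_of)
  with subset_UNIV show ?thesis
    by (induction f rule: frag_induction)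
      (simp_all add: z monoid_ring_mult(2-) augmentation_diff augmentation_frag_of left_diff_distrib)
qed

lemma trivial_module_frag_of: "frag_of x \<odot>\<^bsub>trivial_module\<^esub> k = k"
  by (simp add: trivial_module_def augmentation_frag_of)

lemma abelian_group_trivial_module: "abelian_group trivial_module"
  by (rule abelian_groupI) (auto simp: trivial_module_def intro: exI[of _ "- x" for x :: int])

lemma left_module_trivial_module:
  "monoid M \<Longrightarrow> left_module (monoid_ring M) trivial_module"
  by (intro left_module.intro left_module_axioms.intro ring_monoid_ring abelian_group_trivial_module)
    (simp_all add: trivial_module_def augmentation_mult augmentation_add augmentation_frag_of
      monoid_ring_sel distrib_left distrib_right)

lemma right_module_trivial_module:
  "monoid M \<Longrightarrow> right_module (monoid_ring M) trivial_module"
  by (intro right_module.intro right_module_axioms.intro ring_monoid_ring abelian_group_trivial_module)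
    (simp_all add: trivial_module_def augmentation_mult augmentation_add augmentation_frag_of
      monoid_ring_sel distrib_left distrib_right)

text \<open>The modules of the resolution are carried by sets of sequences over the monoid ring. This is
  no restriction: this type hosts a copy of the free module of rank \<open>k\<close> for every \<open>k\<close>, so every
  resolution by finitely generated free modules is isomorphic to one of this form.\<close>

definition left_FP_infty :: "('a, 'm) monoid_scheme \<Rightarrow> bool" where
  "left_FP_infty M \<longleftrightarrow>
    (\<exists>(F :: nat \<Rightarrow> ('a \<Rightarrow>\<^sub>0 int, nat \<Rightarrow> 'a \<Rightarrow>\<^sub>0 int) module) d e.
      (\<forall>i. left_module (monoid_ring M) (F i)) \<and>
      fg_free_resolution (monoid_ring M) F d e trivial_module)"

definition right_FP_infty :: "('a, 'm) monoid_scheme \<Rightarrow> bool" where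
  "right_FP_infty M \<longleftrightarrow>
    (\<exists>(F :: nat \<Rightarrow> ('a \<Rightarrow>\<^sub>0 int, nat \<Rightarrow> 'a \<Rightarrow>\<^sub>0 int) module) d e.
      (\<forall>i. right_module (monoid_ring M) (F i)) \<and>
      fg_free_resolution (monoid_ring M) F d e trivial_module)"

end

theory Submission
  imports Defs
begin

text \<open>
  Every element of \<open>M\<^sub>n\<close> is a product of columns (strictly decreasing words), and it has exactly one
  factorisation into columns in which neighbouring columns fit together in a tableau. Inserting one
  column into another rewrites a product of two columns that do not fit as a product of at most
  two columns, the first of them longer than before. So tableaux are the normal forms of a finite
  complete rewriting system whose left-hand sides have length 2.

  Such a system yields the Anick resolution: its basis in degree \<open>k\<close> is the finite set of words
  of \<open>k\<close> generators in which every two neighbours are reducible. Boundaries and exactness are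
  obtained simultaneously by induction on the degree, since every boundary is triangular with
  respect to the order of the rewriting system. Reversing all words gives such a system for the
  opposite monoid, whose left modules are the right modules of \<open>M\<^sub>n\<close>.
\<close>

section \<open>Column insertion\<close>

text \<open>Uniqueness of the factorisation is not checked on overlaps of rules. It follows from an
  invariant: inserting congruent words into a column gives the same new column and congruent bumped
  words. Inserting a tableau into the empty column therefore reads off its first column and leaves a
  word for the others. The resolution has an obstacle of its own. The boundary of a chain needs a
  correction term whose existence is exactness one degree lower, and triangularity survives only if
  the correction stays below the chain in the order. So exactness is proved with a bound: a cycle of
  weight below W has a preimage of weight below W.\<close>

definition column_word :: "nat set \<Rightarrow> nat list" where
  "column_word C = rev (sorted_list_of_set C)"

lemma set_column_word [simp]: "finite C \<Longrightarrow> set (column_word C) = C"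
  by (simp add: column_word_def)

lemma sorted_column_word: "sorted_wrt (>) (column_word C)"
  by (simp add: column_word_def sorted_wrt_rev)

lemma length_column_word [simp]: "length (column_word C) = card C"
  by (simp add: column_word_def)

lemma column_word_empty [simp]: "column_word {} = []"
  by (simp add: column_word_def)

lemma column_word_set: "sorted_wrt (>) l \<Longrightarrow> column_word (set l) = l"
proof -
  assume "sorted_wrt (>) l"
  then have "sorted_wrt (<) (rev l)" by (simp add: sorted_wrt_rev)
  then have "sorted (rev l) \<and> distinct (rev l)" by (simp only: strict_sorted_iff)
  then have "sorted_list_of_set (set (rev l)) = rev l"
    by (metis sorted_list_of_set.idem_if_sorted_distinct)
  then show ?thesis by (simp add: column_word_def)
qed

lemma column_word_eqI: "sorted_wrt (>) l \<Longrightarrow> set l = C \<Longrightarrow> column_word C = l"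
  using column_word_set by blast

lemma column_word_lists: "finite C \<Longrightarrow> C \<subseteq> A \<Longrightarrow> column_word C \<in> lists A"
  by auto

text \<open>Inserting the letter \<open>x\<close> into the column \<open>C\<close> from the left bumps the least entry \<open>y \<ge> x\<close>,
  if there is one: \<open>x C = C' y\<close> in the Plactic monoid. The functions below are the new column and
  the bumped word.\<close>

definition ins_col :: "nat \<Rightarrow> nat set \<Rightarrow> nat set" where
  "ins_col x C = (if \<exists>e\<in>C. x \<le> e then insert x (C - {LEAST e. e \<in> C \<and> x \<le> e}) else insert x C)"

definition ins_out :: "nat \<Rightarrow> nat set \<Rightarrow> nat list" where
  "ins_out x C = (if \<exists>e\<in>C. x \<le> e then [LEAST e. e \<in> C \<and> x \<le> e] else [])"

text \<open>A pointwise form of the \<open>LEAST\<close> above, so that a bumped entry can be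
  recognised again after other letters have changed the column.\<close>

definition least_above :: "nat \<Rightarrow> nat set \<Rightarrow> nat \<Rightarrow> bool" where
  "least_above x C y \<longleftrightarrow> y \<in> C \<and> x \<le> y \<and> (\<forall>e\<in>C. x \<le> e \<longrightarrow> y \<le> e)"

lemma ins_bump:
  assumes "least_above x C y"
  shows "ins_col x C = insert x (C - {y})" "ins_out x C = [y]"
proof -
  have "(LEAST e. e \<in> C \<and> x \<le> e) = y"
    using assms by (intro Least_equality) (auto simp: least_above_def)
  then show "ins_col x C = insert x (C - {y})" "ins_out x C = [y]"
    using assms by (auto simp: ins_col_def ins_out_def least_above_def)
qed

lemma ins_no_bump:
  assumes "\<forall>e\<in>C. e < x"
  shows "ins_col x C = insert x C" "ins_out x C = []"
  using assms by (auto simp: ins_col_def ins_out_def not_le)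

lemma ins_cases:
  obtains y where "least_above x C y" | "\<forall>e\<in>C. e < x"
proof (cases "\<exists>e. e \<in> C \<and> x \<le> e")
  case True
  then have "least_above x C (LEAST e. e \<in> C \<and> x \<le> e)"
    unfolding least_above_def using LeastI_ex[OF True] by (auto intro: Least_le)
  then show ?thesis using that by blast
qed (use that in \<open>force simp: not_le\<close>)

fun word_col :: "nat list \<Rightarrow> nat set \<Rightarrow> nat set" where
  "word_col [] C = C"
| "word_col (x # w) C = ins_col x (word_col w C)"

text \<open>The last letter goes in first. From w C = C' o and x C' = C'' y one gets x w C = C'' y
  o, so the newest bumped letter stands in front.\<close>

fun word_out :: "nat list \<Rightarrow> nat set \<Rightarrow> nat list" where
  "word_out [] C = []"
| "word_out (x # w) C = ins_out x (word_col w C) @ word_out w C"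

lemma word_col_append: "word_col (u @ v) C = word_col u (word_col v C)"
  by (induction u) auto

lemma word_out_append: "word_out (u @ v) C = word_out u (word_col v C) @ word_out v C"
  by (induction u) (auto simp: word_col_append)

lemma ins_col_subset: "x \<in> A \<Longrightarrow> C \<subseteq> A \<Longrightarrow> ins_col x C \<subseteq> A"
  by (auto simp: ins_col_def)

lemma ins_out_lists: "C \<subseteq> A \<Longrightarrow> ins_out x C \<in> lists A"
  by (rule ins_cases[of x C]) (auto simp: ins_bump(2) ins_no_bump(2) least_above_def)

lemma word_col_subset: "w \<in> lists A \<Longrightarrow> C \<subseteq> A \<Longrightarrow> word_col w C \<subseteq> A"
proof (induction w)
  case (Cons x w)
  then show ?case using ins_col_subset[of x A "word_col w C"] by auto
qed auto

lemma word_out_lists: "w \<in> lists A \<Longrightarrow> C \<subseteq> A \<Longrightarrow> word_out w C \<in> lists A"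
proof (induction w)
  case (Cons x w)
  then show ?case
    using ins_out_lists[OF word_col_subset[of w A C], of x] by (simp del: in_lists_conv_set)
qed auto

section \<open>Invariance of column insertion under the Plactic congruence\<close>

abbreviation plactic_cong :: "nat \<Rightarrow> (nat list \<times> nat list) set" where
  "plactic_cong n \<equiv> pres_cong {1..n} (plactic_rels n)"

lemma plactic_cong_lists: "(u, v) \<in> plactic_cong n \<Longrightarrow> u \<in> lists {1..n} \<and> v \<in> lists {1..n}"
  by (rule pres_cong_lists[OF plactic_rels_lists])

lemma plactic_cong_left: "(u, v) \<in> plactic_cong n \<Longrightarrow> w \<in> lists {1..n} \<Longrightarrow> (w @ u, w @ v) \<in> plactic_cong n"
  by (rule pres_cong.mult[OF pres_cong.refl])

lemma plactic_cong_right: "(u, v) \<in> plactic_cong n \<Longrightarrow> w \<in> lists {1..n} \<Longrightarrow> (u @ w, v @ w) \<in> plactic_cong n"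
  by (rule pres_cong.mult[OF _ pres_cong.refl])

lemma knuth1:
  "{x, y, z} \<subseteq> {1..n} \<Longrightarrow> x \<le> y \<Longrightarrow> y < z \<Longrightarrow> ([x, z, y], [z, x, y]) \<in> plactic_cong n"
  by (rule pres_cong.gen) (auto simp: plactic_rels_def)

lemma knuth2:
  "{x, y, z} \<subseteq> {1..n} \<Longrightarrow> x < y \<Longrightarrow> y \<le> z \<Longrightarrow> ([y, x, z], [y, z, x]) \<in> plactic_cong n"
  by (rule pres_cong.gen) (auto simp: plactic_rels_def)

text \<open>Once y is in the column, x bumps an entry \<le> y while z acts only above y, so these
  two insertions commute. The bumped letters satisfy x' \<le> y' < z', so the outputs differ by the
  same Knuth relation; if z bumps nothing, they coincide.\<close>

lemma insert_knuth1:
  assumes "x \<le> y" "y < z" "{x, y, z} \<subseteq> {1..n}" "C \<subseteq> {1..n}"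
  shows "word_col [x, z, y] C = word_col [z, x, y] C \<and>
    (word_out [x, z, y] C, word_out [z, x, y] C) \<in> plactic_cong n"
proof -
  define D where "D = ins_col y C"
  have yD: "y \<in> D" by (auto simp: D_def ins_col_def)
  have DA: "D \<subseteq> {1..n}" unfolding D_def by (rule ins_col_subset) (use assms in auto)
  obtain x' where x': "least_above x D x'"
    by (rule ins_cases[of x D]) (use yD assms(1) in auto)
  have x'y: "x' \<le> y" using x' yD assms(1) by (auto simp: least_above_def)
  show ?thesis
  proof (rule ins_cases[of z D])
    fix z' assume z': "least_above z D z'"
    have zz: "y < z'" "z' \<in> D" using z' assms(2) by (auto simp: least_above_def)
    have 1: "least_above x (insert z (D - {z'})) x'" and 2: "least_above z (insert x (D - {x'})) z'"
      using x' z' x'y assms(1,2) by (auto simp: least_above_def)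
    \<comment> \<open>If y bumped nothing, it would be the largest entry of \<open>D\<close> and
      nothing would be left for z to bump.\<close>
    obtain y' where y': "least_above y C y'"
    proof (rule ins_cases[of y C])
      assume "\<forall>e\<in>C. e < y"
      then have "D = insert y C" by (simp add: D_def ins_no_bump)
      with zz \<open>\<forall>e\<in>C. e < y\<close> show ?thesis by auto
    qed
    have D: "D = insert y (C - {y'})" by (simp add: D_def ins_bump[OF y'])
    have y'z': "y' < z'"
      using y' zz unfolding D by (auto simp: least_above_def order_le_less)
    have mem: "{x', y', z'} \<subseteq> {1..n}"
      using x' y' z' DA assms(4) by (auto simp: least_above_def)
    have "x' \<le> y'" using x'y y' by (auto simp: least_above_def)
    then have "([x', z', y'], [z', x', y']) \<in> plactic_cong n" using knuth1 mem y'z' by blast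
    then show ?thesis
      using zz x'y assms(1,2)
      by (auto simp: ins_bump[OF x'] ins_bump(2)[OF y'] ins_bump[OF z'] ins_bump[OF 1] ins_bump[OF 2]
          D_def[symmetric])
  next
    assume z': "\<forall>e\<in>D. e < z"
    have 1: "least_above x (insert z D) x'" and 2: "\<forall>e\<in>insert x (D - {x'}). e < z"
      using x' z' x'y assms(1,2) by (auto simp: least_above_def)
    have l: "[x'] @ ins_out y C \<in> lists {1..n}"
      using ins_out_lists[OF assms(4)] x' DA by (auto simp: least_above_def)
    have "insert x (insert z D - {x'}) = insert z (insert x (D - {x'}))"
      using x'y assms(2) by auto
    then show ?thesis using pres_cong.refl[OF l]
      by (simp add: D_def[symmetric] ins_bump[OF x'] ins_bump[OF 1] ins_no_bump[OF z'] ins_no_bump[OF 2])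
  qed
qed

text \<open>If some entry lies in [x, z), then x and z bump different entries, their insertions
  commute, and the outputs differ by the second relation with x' < y' \<le> z'. If there is none,
  whichever of x and z comes first bumps z', and the outputs z'' z z' and z z'' z' differ by the
  first relation. Where fewer letters are bumped the outputs agree.\<close>

lemma insert_knuth2:
  assumes "x < y" "y \<le> z" "{x, y, z} \<subseteq> {1..n}" "C \<subseteq> {1..n}"
  shows "word_col [y, x, z] C = word_col [y, z, x] C \<and>
    (word_out [y, x, z] C, word_out [y, z, x] C) \<in> plactic_cong n"
proof (cases "\<exists>e\<in>C. x \<le> e \<and> e < z")
  case True
  then obtain e where e: "e \<in> C" "x \<le> e" "e < z" by blast
  obtain x' where x': "least_above x C x'"
    by (rule ins_cases[of x C]) (use e in auto)
  have x'z: "x' < z" using x' e by (auto simp: least_above_def)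
  \<comment> \<open>\<open>Z\<close> and \<open>zo\<close> are the entry bumped by z as a set and as
    a word, both empty if there is none; one argument then covers both cases.\<close>
  have main: "word_col [y, x, z] C = word_col [y, z, x] C \<and>
    (word_out [y, x, z] C, word_out [y, z, x] C) \<in> plactic_cong n"
    if E: "ins_col z C = insert z (C - Z)" "ins_out z C = zo"
      "ins_col z (insert x (C - {x'})) = insert z (insert x (C - {x'}) - Z)"
      "ins_out z (insert x (C - {x'})) = zo"
      and Z: "Z \<subseteq> {z'. least_above z C z'}" "(Z = {} \<and> zo = []) \<or> (\<exists>z'. Z = {z'} \<and> zo = [z'])"
    for Z zo
  proof -
    have x1: "least_above x (insert z (C - Z)) x'"
      using x' x'z Z(1) by (auto simp: least_above_def)
    define C2 where "C2 = insert x (insert z (C - Z) - {x'})"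
    have x_notin_Z: "x \<notin> Z" "x' \<notin> Z" using Z(1) assms x'z by (auto simp: least_above_def)
    have C2': "insert z (insert x (C - {x'}) - Z) = C2"
      using x'z x_notin_Z by (auto simp: C2_def)
    have "z \<in> C2" using x'z by (simp add: C2_def)
    then obtain y' where y': "least_above y C2 y'"
      by (rule_tac ins_cases[of y C2]) (use assms in auto)
    have "y' \<le> z" using y' x'z assms by (auto simp: least_above_def C2_def)
    have "x' < y'" using y' x'z x' assms(1)
      by (auto simp: least_above_def C2_def order_le_less)
    have "y' \<in> {1..n}" "x' \<in> {1..n}"
      using y' x' assms by (auto simp: least_above_def C2_def)
    then have "([y'] @ [x'] @ zo, [y'] @ zo @ [x']) \<in> plactic_cong n"
    proof (cases "zo = []")
      case False
      then obtain z' where z': "zo = [z']" "least_above z C z'" using Z by auto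
      have "y' \<le> z'" "z' \<in> {1..n}" using \<open>y' \<le> z\<close> z' assms by (auto simp: least_above_def)
      then show ?thesis
        using knuth2[of x' y' z' n] \<open>x' < y'\<close> \<open>y' \<in> {1..n}\<close> \<open>x' \<in> {1..n}\<close> z' by auto
    qed (auto intro!: pres_cong.refl)
    then show ?thesis
      by (simp add: E ins_bump[OF x'] ins_bump[OF x1] C2_def[symmetric] C2' ins_bump[OF y'])
  qed
  show ?thesis
  proof (rule ins_cases[of z C])
    fix z' assume z': "least_above z C z'"
    then have 1: "least_above z (insert x (C - {x'})) z'"
      using x' x'z assms by (auto simp: least_above_def)
    show ?thesis
      by (rule main[where Z = "{z'}"]) (auto simp: ins_bump[OF z'] ins_bump[OF 1] z')
  next
    assume z': "\<forall>e\<in>C. e < z"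
    then have 1: "\<forall>e\<in>insert x (C - {x'}). e < z" using assms by auto
    show ?thesis
      by (rule main[where Z = "{}"]) (auto simp: ins_no_bump[OF z'] ins_no_bump[OF 1])
  qed
next
  case False
  then have gap: "z \<le> e" if "e \<in> C" "x \<le> e" for e using that by force
  show ?thesis
  proof (rule ins_cases[of z C])
    fix z' assume z': "least_above z C z'"
    have 1: "least_above x C z'" and 2: "least_above x (insert z (C - {z'})) z"
      using z' gap assms by (auto simp: least_above_def)
    define D where "D = insert x (C - {z'})"
    have D2: "insert x (insert z (C - {z'}) - {z}) = D"
      using z' gap assms by (auto simp: D_def least_above_def)
    define E where "E = insert z (C - {z'})"
    have E: "ins_col z C = E" "ins_col x E = D" "ins_out x E = [z]"
      and D: "ins_col x C = D"
      using ins_bump[OF z'] ins_bump[OF 2] ins_bump[OF 1] D2 unfolding D_def E_def by blast+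
    note outs = ins_bump(2)[OF z'] ins_bump(2)[OF 1]
    show ?thesis
    proof (rule ins_cases[of z D])
      fix z'' assume z'': "least_above z D z''"
      have 3: "least_above y D z''" and 4: "least_above y (insert z (D - {z''})) z"
        using z'' gap assms by (auto simp: least_above_def D_def)
      have "z'' \<in> C" "z'' \<noteq> z'" "z \<le> z''" using z'' assms(1,2) by (auto simp: least_above_def D_def)
      then have "z' < z''" using z' by (metis least_above_def order_le_less)
      then have "([z, z'', z'], [z'', z, z']) \<in> plactic_cong n"
        using z' z'' assms by (intro knuth1) (auto simp: least_above_def D_def)
      moreover have "insert y (D - {z''}) = insert y (insert z (D - {z''}) - {z})"
        using z'' gap assms by (auto simp: D_def least_above_def)
      ultimately show ?thesis
        by (simp add: E D outs ins_bump[OF z''] ins_bump[OF 3] ins_bump[OF 4] pres_cong.sym del: insert_Diff_single)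
    next
      assume z'': "\<forall>e\<in>D. e < z"
      have 3: "\<forall>e\<in>D. e < y"
      proof
        fix e assume e: "e \<in> D"
        then have "e < z" using z'' by blast
        then show "e < y" using e gap[of e] assms(1) by (cases "x \<le> e") (auto simp: D_def)
      qed
      have 4: "least_above y (insert z D) z" using 3 assms by (auto simp: least_above_def)
      have "[z, z'] \<in> lists {1..n}" using z' assms by (auto simp: least_above_def)
      moreover have "insert y D = insert y (insert z D - {z})" using z'' by auto
      ultimately show ?thesis
        by (simp only: E D outs ins_no_bump[OF z''] ins_no_bump[OF 3] ins_bump[OF 4] word_col.simps
            word_out.simps append.simps pres_cong.refl simp_thms)
    qed
  next
    assume z': "\<forall>e\<in>C. e < z"
    have lt: "\<forall>e\<in>C. e < x" using z' gap by (meson leD not_le_imp_less)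
    have 2: "least_above x (insert z C) z" and 3: "\<forall>e\<in>insert x C. e < z"
      and 4: "\<forall>e\<in>insert x C. e < y" and 5: "least_above y (insert z (insert x C)) z"
      using lt assms by (auto simp: least_above_def)
    have "insert x (insert z C - {z}) = insert x C"
      "insert y (insert z (insert x C) - {z}) = insert y (insert x C)"
      using z' assms by auto
    then show ?thesis using assms
      by (auto simp: ins_no_bump[OF z'] ins_no_bump[OF lt] ins_bump[OF 2] ins_no_bump[OF 3] ins_no_bump[OF 4]
            ins_bump[OF 5] intro!: pres_cong.refl)
  qed
qed

text \<open>This makes insertion an invariant of elements of the monoid. The output words are part
  of the claim because the uniqueness of tableaux recurses on them.\<close>

lemma insert_plactic_cong:
  assumes "(u, v) \<in> plactic_cong n" "C \<subseteq> {1..n}"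
  shows "word_col u C = word_col v C \<and> (word_out u C, word_out v C) \<in> plactic_cong n"
  using assms
proof (induction arbitrary: C)
  case (gen u v)
  from gen.hyps have "(\<exists>x y z. u = [x, z, y] \<and> v = [z, x, y] \<and> {x, y, z} \<subseteq> {1..n} \<and> x \<le> y \<and> y < z) \<or>
      (\<exists>x y z. u = [y, x, z] \<and> v = [y, z, x] \<and> {x, y, z} \<subseteq> {1..n} \<and> x < y \<and> y \<le> z)"
    by (simp only: plactic_rels_def Un_iff mem_Collect_eq prod.inject conj_assoc)
  then show ?case
  proof (elim disjE exE conjE)
    fix x y z assume "u = [x, z, y]" "v = [z, x, y]" "{x, y, z} \<subseteq> {1..n}" "x \<le> y" "y < z"
    then show ?case using insert_knuth1[of x y z n C] gen.prems by simp
  next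
    fix x y z assume "u = [y, x, z]" "v = [y, z, x]" "{x, y, z} \<subseteq> {1..n}" "x < y" "y \<le> z"
    then show ?case using insert_knuth2[of x y z n C] gen.prems by simp
  qed
next
  case (refl w)
  then show ?case using word_out_lists by (blast intro: pres_cong.refl)
next
  case (sym u v)
  then show ?case by (metis pres_cong.sym)
next
  case (trans u v w)
  then show ?case by (metis pres_cong.trans)
next
  case (mult u v u' v')
  have "word_col u' C \<subseteq> {1..n}"
    using word_col_subset[OF conjunct1[OF plactic_cong_lists[OF mult.hyps(2)]] mult.prems] .
  then show ?case using mult.IH mult.prems by (simp add: word_col_append word_out_append pres_cong.mult)
qed

section \<open>Column insertion as an identity of the Plactic monoid\<close>

lemma column_bubble:
  assumes "sorted_wrt (>) (x # l)" "x \<le> b" "set (b # x # l) \<subseteq> {1..n}"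
  shows "(x # b # l, x # l @ [b]) \<in> plactic_cong n"
  using assms
proof (induction l arbitrary: x)
  case Nil
  then show ?case by (auto intro!: pres_cong.refl)
next
  case (Cons c l)
  \<comment> \<open>The second relation for c < x \<le> b: the x in front lets b move past c.
    Afterwards c takes the part of x.\<close>
  have "([x, b, c], [x, c, b]) \<in> plactic_cong n"
    using Cons.prems by (intro pres_cong.sym[OF knuth2]) auto
  from plactic_cong_right[OF this, of l] have "(x # b # c # l, x # c # b # l) \<in> plactic_cong n"
    using Cons.prems by auto
  moreover have "(c # b # l, c # l @ [b]) \<in> plactic_cong n"
    using Cons.prems by (intro Cons.IH) auto
  from plactic_cong_left[OF this, of "[x]"] have "(x # c # b # l, x # c # l @ [b]) \<in> plactic_cong n"
    using Cons.prems by auto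
  ultimately show ?case by (auto intro: pres_cong.trans)
qed

lemma insert_letter_cong:
  assumes "sorted_wrt (>) l" "set (x # l) \<subseteq> {1..n}"
  shows "(x # l, column_word (ins_col x (set l)) @ ins_out x (set l)) \<in> plactic_cong n"
  using assms
proof (induction l)
  case Nil
  have "column_word {x} = [x]" by (intro column_word_eqI) auto
  then show ?case using Nil by (auto simp: ins_no_bump intro!: pres_cong.refl)
next
  case (Cons b l)
  consider "b < x" | "x \<le> b" "\<forall>e\<in>set l. e < x" | e where "e \<in> set l" "x \<le> e" by force
  then show ?case
  proof cases
    case 1
    then have "\<forall>e\<in>set (b # l). e < x" using Cons.prems by auto
    moreover have "column_word (insert x (set (b # l))) = x # b # l"
      using Cons.prems calculation by (intro column_word_eqI) auto
    moreover have "x # b # l \<in> lists {1..n}" using Cons.prems(2) by (simp add: in_lists_conv_set subset_iff)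
    ultimately show ?thesis by (simp add: ins_no_bump pres_cong.refl del: in_lists_conv_set)
  next
    case 2
    then have b: "least_above x (set (b # l)) b" by (auto simp: least_above_def)
    have "insert x (set (b # l) - {b}) = set (x # l)" using Cons.prems by auto
    moreover have xl: "sorted_wrt (>) (x # l)" using 2 Cons.prems by auto
    ultimately have "column_word (ins_col x (set (b # l))) = x # l"
      using column_word_set[OF xl] by (simp only: ins_bump[OF b])
    then show ?thesis using column_bubble[OF xl 2(1)] Cons.prems(2) unfolding ins_bump(2)[OF b] by auto
  next
    case 3
    then obtain y where y: "least_above x (set l) y"
      by - (rule ins_cases[of x "set l"], auto)
    have y2: "least_above x (set (b # l)) y"
      using y Cons.prems by (auto simp: least_above_def)
    let ?c = "column_word (insert x (set l - {y}))"
    have IH: "(x # l, ?c @ [y]) \<in> plactic_cong n" using Cons by (simp add: ins_bump[OF y])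
    have bx: "x < b" "y < b" using y Cons.prems by (auto simp: least_above_def)
    have c: "column_word (ins_col x (set (b # l))) = b # ?c"
      unfolding ins_bump[OF y2] using bx Cons.prems
      by (intro column_word_eqI) (auto simp: sorted_column_word)
    \<comment> \<open>Here x bumps an entry of the tail, so the head \<open>h\<close> of the tail
      satisfies x \<le> h < b, and the first relation carries x past b.\<close>
    from 3 obtain h l' where l: "l = h # l'" by (cases l) auto
    have "([x, b, h], [b, x, h]) \<in> plactic_cong n"
      using 3 Cons.prems unfolding l by (intro knuth1) auto
    from plactic_cong_right[OF this, of l'] have "(x # b # l, b # x # l) \<in> plactic_cong n"
      using Cons.prems by (auto simp: l)
    moreover have "(b # x # l, b # ?c @ [y]) \<in> plactic_cong n"
      using plactic_cong_left[OF IH, of "[b]"] Cons.prems by auto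
    ultimately show ?thesis unfolding c ins_bump(2)[OF y2] by (auto intro: pres_cong.trans)
  qed
qed

lemma insert_word_cong:
  assumes "w \<in> lists {1..n}" "C \<subseteq> {1..n}"
  shows "(w @ column_word C, column_word (word_col w C) @ word_out w C) \<in> plactic_cong n"
  using assms(1)
proof (induction w)
  case Nil
  then show ?case
    using column_word_lists[OF finite_subset[OF assms(2)] assms(2)] by (auto intro!: pres_cong.refl)
next
  case (Cons x w)
  define D where "D = word_col w C"
  have D: "D \<subseteq> {1..n}" "finite D"
  proof -
    from word_col_subset[OF Cons.hyps(2) assms(2)] show "D \<subseteq> {1..n}" by (simp only: D_def)
    then show "finite D" by (rule finite_subset) simp
  qed
  have "(x # w @ column_word C, x # column_word D @ word_out w C) \<in> plactic_cong n"
    using plactic_cong_left[OF Cons.IH, of "[x]"] Cons.hyps by (auto simp: D_def)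
  moreover have "(x # column_word D, column_word (ins_col x D) @ ins_out x D) \<in> plactic_cong n"
    using insert_letter_cong[OF sorted_column_word, of x D n] D Cons.hyps by auto
  from plactic_cong_right[OF this, of "word_out w C"]
  have "(x # column_word D @ word_out w C, column_word (ins_col x D) @ ins_out x D @ word_out w C) \<in> plactic_cong n"
    using word_out_lists[of w "{1..n}" C] Cons.hyps assms(2) by auto
  ultimately show ?case by (auto simp: D_def intro: pres_cong.trans)
qed

text \<open>The last conjunct drives the induction: the next letter exceeds those inserted so far,
  hence bumps an entry larger than all earlier outputs. So the output of a column is decreasing,
  that is, again a column.\<close>

lemma insert_sorted_word:
  assumes "sorted_wrt (>) w"
  shows "sorted_wrt (>) (word_out w C) \<and> set (word_out w C) \<subseteq> C \<and>
    word_col w C = (C - set (word_out w C)) \<union> set w \<and>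
    (\<forall>e\<in>word_col w C. (\<forall>x\<in>set w. x < e) \<longrightarrow> (\<forall>y\<in>set (word_out w C). y < e))"
  using assms
proof (induction w)
  case (Cons x w)
  have w: "sorted_wrt (>) w" and xw: "\<forall>x'\<in>set w. x' < x" using Cons.prems by auto
  have IH: "sorted_wrt (>) (word_out w C)" "set (word_out w C) \<subseteq> C"
    "word_col w C = (C - set (word_out w C)) \<union> set w"
    "\<forall>e\<in>word_col w C. (\<forall>x\<in>set w. x < e) \<longrightarrow> (\<forall>y\<in>set (word_out w C). y < e)"
    using Cons.IH[OF w] by blast+
  show ?case
  proof (rule ins_cases[of x "word_col w C"])
    fix y assume y: "least_above x (word_col w C) y"
    then have yw: "\<forall>x\<in>set w. x < y" "y \<in> word_col w C" "x \<le> y" using xw by (auto simp: least_above_def)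
    then have lt: "\<forall>z\<in>set (word_out w C). z < y" using IH(4) by blast
    have yC: "y \<in> C" using yw IH(3) by auto
    have col: "insert x (word_col w C - {y}) = (C - set (y # word_out w C)) \<union> set (x # w)"
      using yw unfolding IH(3) by auto
    have o: "word_out (x # w) C = y # word_out w C"
      and c: "word_col (x # w) C = insert x (word_col w C - {y})"
      by (simp_all add: ins_bump[OF y])
    have bound: "z < e" if "e \<in> insert x (word_col w C - {y})" "\<forall>x'\<in>set (x # w). x' < e"
      "z \<in> set (y # word_out w C)" for e z
    proof -
      have e: "e \<in> word_col w C" "e \<noteq> y" "x < e" using that by auto
      have "y \<le> e" using y e(1,3) by (simp add: least_above_def)
      then have "y < e" using e(2) by simp
      then show ?thesis using that(3) lt by auto
    qed
    have "sorted_wrt (>) (y # word_out w C)" using IH(1) lt by simp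
    moreover have "set (y # word_out w C) \<subseteq> C" using IH(2) yC by simp
    ultimately show ?thesis unfolding o c using col bound by blast
  next
    assume above: "\<forall>e\<in>word_col w C. e < x"
    have o: "word_out (x # w) C = word_out w C" and c: "word_col (x # w) C = insert x (word_col w C)"
      by (simp_all add: ins_no_bump[OF above])
    have "insert x (word_col w C) = (C - set (word_out w C)) \<union> set (x # w)" using IH(3) by simp
    moreover have "z < e" if "e \<in> insert x (word_col w C)" "\<forall>x'\<in>set (x # w). x' < e"
      "z \<in> set (word_out w C)" for e z
      using that IH(4) by auto
    ultimately show ?thesis unfolding o c using IH(1,2) by blast
  qed
qed auto

text \<open>Two columns stand next to each other in a tableau iff inserting the left one into the right
  one displaces every entry of the right one.\<close>

definition tableau_pair :: "nat set \<Rightarrow> nat set \<Rightarrow> bool" where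
  "tableau_pair C D \<longleftrightarrow> word_col (column_word C) D = C \<and> word_out (column_word C) D = column_word D"

text \<open>Insertion conserves the number of letters, so card E + card F = card C + card D. Hence E
  is longer than C as soon as F is a proper subset of D; F = D would force E = C and make the pair a
  tableau pair.\<close>

lemma insert_column:
  assumes "finite C" "finite D" "\<not> tableau_pair C D"
  defines "E \<equiv> word_col (column_word C) D" and "F \<equiv> set (word_out (column_word C) D)"
  shows "word_out (column_word C) D = column_word F" "F \<subseteq> D" "card C < card E" "E \<subseteq> C \<union> D"
proof -
  note * = insert_sorted_word[OF sorted_column_word, of C D]
  show F: "word_out (column_word C) D = column_word F" "F \<subseteq> D"
    using * column_word_set by (auto simp: F_def)
  have E: "E = (D - F) \<union> C" using * assms(1) by (simp add: E_def F_def)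
  then show "E \<subseteq> C \<union> D" by auto
  have "finite (word_col w D) \<and> card (word_col w D) + length (word_out w D) = card D + length w" for w
  proof (induction w)
    case (Cons x w)
    show ?case
    proof (rule ins_cases[of x "word_col w D"])
      fix y assume y: "least_above x (word_col w D) y"
      have "card (insert x (word_col w D - {y})) = card (word_col w D)"
      proof (cases "x = y")
        case True
        then show ?thesis using y by (simp add: least_above_def insert_absorb)
      next
        case False
        then have "x \<notin> word_col w D" using y by (auto simp: least_above_def)
        moreover have "y \<in> word_col w D" using y by (simp add: least_above_def)
        ultimately show ?thesis using Cons card_Suc_Diff1[of "word_col w D" y] by simp
      qed
      then show ?thesis using Cons by (simp add: ins_bump[OF y])
    next
      assume "\<forall>e\<in>word_col w D. e < x"
      then show ?thesis using Cons by (auto simp: ins_no_bump card_insert_if)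
    qed
  qed (simp add: assms)
  from this[of "column_word C"] have "card E + card F = card D + card C"
    using assms(1) by (simp add: E_def F)
  moreover have "F \<noteq> D"
  proof
    assume "F = D"
    then have "E = C" using E by auto
    then show False using assms(3) \<open>F = D\<close> F by (simp add: tableau_pair_def E_def)
  qed
  then have "card F < card D" using F assms(2) by (simp add: psubset_card_mono psubset_eq)
  ultimately show "card C < card E" by simp
qed

section \<open>Uniqueness of the tableau factorisation\<close>

abbreviation columns_word :: "nat set list \<Rightarrow> nat list" where
  "columns_word T \<equiv> concat (map column_word T)"

text \<open>Inserting from the right, each column displaces all of the previous one, so the working
  column is always the leftmost one inserted so far.\<close>

lemma insert_tableau:
  assumes "successively tableau_pair T" "\<forall>C\<in>set T. finite C"
  shows "word_col (columns_word T) {} = (case T of [] \<Rightarrow> {} | C # T' \<Rightarrow> C) \<and>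
    word_out (columns_word T) {} = columns_word (tl T)"
  using assms
proof (induction T)
  case (Cons C T)
  show ?case
  proof (cases T)
    case Nil
    have "word_out (column_word C) {} = []" "word_col (column_word C) {} = C"
      using insert_sorted_word[OF sorted_column_word, of C "{}"] Cons.prems by auto
    then show ?thesis using Nil by simp
  next
    case (Cons D T')
    then show ?thesis using Cons.IH Cons.prems
      by (auto simp: word_col_append word_out_append tableau_pair_def)
  qed
qed auto

text \<open>Both words are inserted into the empty column. The resulting columns, which are the
  first columns of the two tableaux, agree, and the outputs are congruent tableaux with one column
  less.\<close>

lemma tableau_unique:
  assumes "(columns_word S, columns_word T) \<in> plactic_cong n"
    "successively tableau_pair S" "\<forall>C\<in>set S. finite C \<and> C \<noteq> {}"
    "successively tableau_pair T" "\<forall>C\<in>set T. finite C \<and> C \<noteq> {}"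
  shows "S = T"
  using assms
proof (induction S arbitrary: T)
  case Nil
  then show ?case
    using insert_plactic_cong[OF Nil.prems(1), of "{}"] insert_tableau[of T] by (cases T) auto
next
  case (Cons C S)
  note ins = insert_plactic_cong[OF Cons.prems(1), of "{}"] insert_tableau[of "C # S"] insert_tableau[of T]
  obtain D T' where T: "T = D # T'" using ins Cons.prems by (cases T) auto
  have "C = D" "(columns_word S, columns_word T') \<in> plactic_cong n" using ins Cons.prems by (auto simp: T)
  moreover have "successively tableau_pair S" "\<forall>C\<in>set S. finite C \<and> C \<noteq> {}"
    "successively tableau_pair T'" "\<forall>C\<in>set T'. finite C \<and> C \<noteq> {}"
    using Cons.prems(2-5) by (simp_all add: T successively_Cons) (metis successively.simps(1))+
  ultimately have "S = T'" by (intro Cons.IH)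
  with \<open>C = D\<close> show ?case by (simp add: T)
qed

section \<open>The Anick resolution of a quadratic complete system\<close>

definition monoid_eval :: "('a, 'm) monoid_scheme \<Rightarrow> ('g \<Rightarrow> 'a) \<Rightarrow> 'g list \<Rightarrow> 'a" where
  "monoid_eval M gen w = foldr (\<lambda>g x. gen g \<otimes>\<^bsub>M\<^esub> x) w \<one>\<^bsub>M\<^esub>"

lemma lookup_frag_extend:
  "Poly_Mapping.lookup (frag_extend f z) x =
    (\<Sum>q\<in>Poly_Mapping.keys z. Poly_Mapping.lookup z q * Poly_Mapping.lookup (f q) x)"
  by (simp add: frag_extend_def lookup_sum)

lemma not_successively_split:
  "\<not> successively P w \<Longrightarrow> \<exists>x a b y. w = x @ [a, b] @ y \<and> \<not> P a b"
proof (induction w)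
  case (Cons a w)
  show ?case
  proof (cases "successively P w")
    case True
    with Cons.prems obtain b y where "w = b # y" "\<not> P a b" by (cases w) auto
    then have "a # w = [] @ [a, b] @ y \<and> \<not> P a b" by simp
    then show ?thesis by blast
  next
    case False
    then obtain x a' b y where "w = x @ [a', b] @ y" "\<not> P a' b" using Cons.IH by blast
    then have "a # w = (a # x) @ [a', b] @ y \<and> \<not> P a' b" by simp
    then show ?thesis by blast
  qed
qed simp

text \<open>A free \<int>M-module on a set of cells is handled as the free abelian group on the
  pairs (m, c), standing for m[c]; the order compares the elements of this \<int>-basis.\<close>

definition left_act :: "('a, 'm) monoid_scheme \<Rightarrow> 'a \<Rightarrow> ('a \<times> 'c \<Rightarrow>\<^sub>0 int) \<Rightarrow> 'a \<times> 'c \<Rightarrow>\<^sub>0 int" where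
  "left_act M m = frag_extend (\<lambda>(x, c). frag_of (m \<otimes>\<^bsub>M\<^esub> x, c))"

lemma left_act_simps [simp]:
  "left_act M m 0 = 0" "left_act M m (frag_of (x, c)) = frag_of (m \<otimes>\<^bsub>M\<^esub> x, c)"
  "left_act M m (y - z) = left_act M m y - left_act M m z"
  "left_act M m (y + z) = left_act M m y + left_act M m z"
  by (simp_all add: left_act_def frag_extend_diff frag_extend_add)

text \<open>\<open>good a b\<close> says that the word \<open>ab\<close> is irreducible, and \<open>val\<close> encodes the reduction order.\<close>

locale quadratic_system = monoid M for M (structure) +
  fixes G :: "'g set" and gen :: "'g \<Rightarrow> 'a" and good :: "'g \<Rightarrow> 'g \<Rightarrow> bool" and val :: "'g list \<Rightarrow> nat"
  assumes finite_gens: "finite G"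
    and gen_closed: "g \<in> G \<Longrightarrow> gen g \<in> carrier M"
    and generates: "m \<in> carrier M \<Longrightarrow> \<exists>w\<in>lists G. monoid_eval M gen w = m"
    and reduce_pair: "\<lbrakk>a \<in> G; b \<in> G; \<not> good a b\<rbrakk> \<Longrightarrow>
        \<exists>v\<in>lists G. monoid_eval M gen v = monoid_eval M gen [a, b] \<and> val v < val [a, b]"
    and unique_normal: "\<lbrakk>u \<in> lists G; v \<in> lists G; successively good u; successively good v;
        monoid_eval M gen u = monoid_eval M gen v\<rbrakk> \<Longrightarrow> u = v"
    and val_mono: "\<lbrakk>u \<in> lists G; v \<in> lists G; x \<in> lists G; y \<in> lists G; val u < val v\<rbrakk> \<Longrightarrow>
        val (x @ u @ y) < val (x @ v @ y)"
    and val_Nil: "a \<in> G \<Longrightarrow> val [] < val [a]"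
begin

abbreviation act :: "'a \<Rightarrow> ('a \<times> 'g list \<Rightarrow>\<^sub>0 int) \<Rightarrow> ('a \<times> 'g list \<Rightarrow>\<^sub>0 int)" where
  "act \<equiv> left_act M"

abbreviation ev :: "'g list \<Rightarrow> 'a" where "ev \<equiv> monoid_eval M gen"

lemma ev_simps [simp]: "ev [] = \<one>" "ev (a # w) = gen a \<otimes> ev w"
  by (simp_all add: monoid_eval_def)

lemma ev_closed [simp]: "w \<in> lists G \<Longrightarrow> ev w \<in> carrier M"
  by (induction w) (auto simp: gen_closed)

lemma ev_append: "u \<in> lists G \<Longrightarrow> v \<in> lists G \<Longrightarrow> ev (u @ v) = ev u \<otimes> ev v"
  by (induction u) (auto simp: gen_closed m_assoc)

section \<open>Normal forms of elements\<close>

definition normal :: "'g list \<Rightarrow> bool" where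
  "normal w \<longleftrightarrow> w \<in> lists G \<and> successively good w"

text \<open>Rewriting stops because each step lowers the natural number \<open>val\<close>. The
  inequality is kept in the claim, since the estimates of weights rest on it.\<close>

lemma exists_normal:
  "w \<in> lists G \<Longrightarrow> \<exists>u. normal u \<and> ev u = ev w \<and> (u = w \<or> val u < val w)"
proof (induction "val w" arbitrary: w rule: less_induct)
  case less
  show ?case
  proof (cases "successively good w")
    case True
    with less.prems show ?thesis by (auto simp: normal_def)
  next
    case False
    then obtain x a b y where w: "w = x @ [a, b] @ y" and ng: "\<not> good a b"
      using not_successively_split by blast
    have G: "x \<in> lists G" "a \<in> G" "b \<in> G" "y \<in> lists G" "[a, b] \<in> lists G"
      using less.prems by (auto simp: w)
    obtain v where v: "v \<in> lists G" "ev v = ev [a, b]" "val v < val [a, b]"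
      using reduce_pair[OF G(2,3) ng] by blast
    have lt: "val (x @ v @ y) < val w" unfolding w by (rule val_mono) (use G v in auto)
    have "x @ v @ y \<in> lists G" using G v by auto
    from less.hyps[OF lt this] obtain u where "normal u" "ev u = ev (x @ v @ y)"
      "val u < val w" using lt by fastforce
    moreover have "ev (x @ v @ y) = ev w"
    proof -
      have "[a, b] @ y \<in> lists G" "v @ y \<in> lists G" using G v by auto
      then show ?thesis
        unfolding w using G(1,4,5) v(1,2) by (simp only: ev_append)
    qed
    ultimately show ?thesis by auto
  qed
qed

definition nf :: "'a \<Rightarrow> 'g list" where
  "nf m = (THE w. normal w \<and> ev w = m)"

lemma nf_eval: "normal w \<Longrightarrow> nf (ev w) = w"
  unfolding nf_def by (rule the_equality) (auto simp: normal_def intro: unique_normal)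

lemma nf: assumes "m \<in> carrier M" shows "normal (nf m)" "ev (nf m) = m"
proof -
  obtain w where "w \<in> lists G" "ev w = m" using generates[OF assms] by blast
  then obtain u where "normal u" "ev u = m" using exists_normal by blast
  then show "normal (nf m)" "ev (nf m) = m" using nf_eval by auto
qed

lemma nf_lists: "m \<in> carrier M \<Longrightarrow> nf m \<in> lists G"
  using nf(1) by (simp add: normal_def)

lemma nf_one [simp]: "nf \<one> = []"
  using nf_eval[of "[]"] by (simp add: normal_def)

lemma nf_gen [simp]: "a \<in> G \<Longrightarrow> nf (gen a) = [a]"
  using nf_eval[of "[a]"] by (simp add: normal_def gen_closed)

lemma val_nf: "w \<in> lists G \<Longrightarrow> nf (ev w) = w \<or> val (nf (ev w)) < val w"
  using exists_normal nf_eval by metis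

section \<open>Chains, cells and weights\<close>

definition chains :: "nat \<Rightarrow> 'g list set" where
  "chains k = {c \<in> lists G. length c = k \<and> successively (\<lambda>a b. \<not> good a b) c}"

lemma finite_chains: "finite (chains k)"
  by (rule finite_subset[OF _ finite_lists_length_eq[OF finite_gens, of k]]) (auto simp: chains_def)

lemma chains_0: "chains 0 = {[]}"
  by (auto simp: chains_def)

lemma chains_Suc:
  assumes "c \<in> chains (Suc k)"
  obtains a c' where "c = a # c'" "a \<in> G" "c' \<in> chains k"
  using assms by (cases c) (auto simp: chains_def successively_Cons)

lemma chains_lists: "c \<in> chains k \<Longrightarrow> c \<in> lists G"
  by (simp add: chains_def)

abbreviation cells :: "nat \<Rightarrow> ('a \<times> 'g list) set" where
  "cells k \<equiv> carrier M \<times> chains k"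

definition cell_span :: "nat \<Rightarrow> ('a \<times> 'g list \<Rightarrow>\<^sub>0 int) set" where
  "cell_span k = {z. Poly_Mapping.keys z \<subseteq> cells k}"

lemma cell_span_simps [simp]:
  "0 \<in> cell_span k" "p \<in> cells k \<Longrightarrow> frag_of p \<in> cell_span k"
  by (auto simp: cell_span_def)

lemma cell_span_diff [simp]: "y \<in> cell_span k \<Longrightarrow> z \<in> cell_span k \<Longrightarrow> y - z \<in> cell_span k"
  using keys_diff[of y z] by (auto simp: cell_span_def)

lemma cell_span_add [simp]: "y \<in> cell_span k \<Longrightarrow> z \<in> cell_span k \<Longrightarrow> y + z \<in> cell_span k"
  using keys_add[of y z] by (auto simp: cell_span_def)

lemma cell_span_extend:
  assumes "z \<in> cell_span k" "\<And>m c. m \<in> carrier M \<Longrightarrow> c \<in> chains k \<Longrightarrow> f (m, c) \<in> cell_span l"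
  shows "frag_extend f z \<in> cell_span l"
  using keys_frag_extend[of f z] assms unfolding cell_span_def by blast

lemma cell_span_induct [consumes 1, case_names zero cell diff]:
  assumes "z \<in> cell_span k" "P 0" "\<And>m c. m \<in> carrier M \<Longrightarrow> c \<in> chains k \<Longrightarrow> P (frag_of (m, c))"
    "\<And>y z. P y \<Longrightarrow> P z \<Longrightarrow> P (y - z)"
  shows "P z"
proof -
  have "Poly_Mapping.keys z \<subseteq> cells k" using assms(1) by (simp add: cell_span_def)
  then show ?thesis
    by (induction z rule: frag_induction) (use assms(2-4) in auto)
qed

lemma act_span: "m \<in> carrier M \<Longrightarrow> z \<in> cell_span k \<Longrightarrow> act m z \<in> cell_span k"
  unfolding left_act_def by (rule cell_span_extend) auto

lemma act_act: "z \<in> cell_span k \<Longrightarrow> m \<in> carrier M \<Longrightarrow> m' \<in> carrier M \<Longrightarrow> act m (act m' z) = act (m \<otimes> m') z"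
  by (induction z rule: cell_span_induct) (simp_all add: m_assoc)

text \<open>The two halves of a cell are read as one word. Moving a letter a from the chain to the
  element m then keeps the weight if \<open>nf m @ [a]\<close> is irreducible and lowers it
  otherwise.\<close>

definition weight :: "'a \<times> 'g list \<Rightarrow> nat" where
  "weight p = val (nf (fst p) @ snd p)"

definition light :: "nat \<Rightarrow> ('a \<times> 'g list \<Rightarrow>\<^sub>0 int) \<Rightarrow> bool" where
  "light W z \<longleftrightarrow> (\<forall>p\<in>Poly_Mapping.keys z. weight p < W)"

lemma light_simps [simp]: "light W 0" "light W (frag_of p) \<longleftrightarrow> weight p < W"
  by (simp_all add: light_def)

lemma light_diff: "light W y \<Longrightarrow> light W z \<Longrightarrow> light W (y - z)"
  using keys_diff[of y z] by (auto simp: light_def)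

lemma light_add: "light W y \<Longrightarrow> light W z \<Longrightarrow> light W (y + z)"
  using keys_add[of y z] by (auto simp: light_def)

lemma light_mono: "light W z \<Longrightarrow> W \<le> W' \<Longrightarrow> light W' z"
  by (auto simp: light_def)

lemma exists_light: "\<exists>W. light W z"
proof
  show "light (Suc (\<Sum>p\<in>Poly_Mapping.keys z. weight p)) z"
    by (auto simp: light_def less_Suc_eq_le intro!: member_le_sum)
qed

text \<open>Replacing \<open>u @ nf x\<close> by the normal form of its value never raises
  \<open>val\<close>, and a prefix \<open>u\<close> preserves the strict bound. This extends
  estimates from the chains c to all cells m[c].\<close>

lemma light_act:
  assumes "y \<in> cell_span k" "light (val c) y" "normal u" "c \<in> lists G"
  shows "light (val (u @ c)) (act (ev u) y)"
  unfolding light_def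
proof
  fix p assume "p \<in> Poly_Mapping.keys (act (ev u) y)"
  from subsetD[OF keys_frag_extend this[unfolded left_act_def]]
  obtain q where q: "q \<in> Poly_Mapping.keys y" "p \<in> Poly_Mapping.keys (case q of (x, c) \<Rightarrow> frag_of (ev u \<otimes> x, c))"
    by blast
  obtain x c' where xc: "q = (x, c')" by (cases q)
  have p: "p = (ev u \<otimes> x, c')" using q by (simp add: xc)
  have x: "x \<in> carrier M" and c': "c' \<in> lists G"
    using assms(1) q chains_lists by (auto simp: cell_span_def xc)
  have u: "u \<in> lists G" using assms(3) by (simp add: normal_def)
  have w: "u @ nf x \<in> lists G" using u nf_lists[OF x] by simp
  have e: "ev u \<otimes> x = ev (u @ nf x)" using ev_append[OF u nf_lists[OF x]] nf[OF x] by simp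
  have "val (nf (ev u \<otimes> x) @ c') \<le> val (u @ nf x @ c')"
    using val_nf[OF w]
  proof
    assume "val (nf (ev (u @ nf x))) < val (u @ nf x)"
    from val_mono[OF _ w _ c' this, of "[]"] show ?thesis
      using w nf_lists[of "ev (u @ nf x)"] by (simp add: e)
  qed (simp add: e)
  also have "val (nf x @ c') < val c" using assms(2) q(1) by (auto simp: light_def weight_def xc)
  from val_mono[OF _ assms(4) u _ this, of "[]"] have "val (u @ nf x @ c') < val (u @ c)"
    using nf_lists[OF x] c' by simp
  finally show "weight p < val (u @ c)" by (simp add: weight_def p)
qed

text \<open>The \<open>\<int>M\<close>-linear map given on the basis by \<open>\<delta>\<close>. In degree 0, where \<open>c = []\<close>, it is the
  augmentation instead, with \<open>\<int>\<close> embedded as the multiples of the cell \<open>(\<one>, [])\<close>.\<close>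

definition linear_ext :: "('g list \<Rightarrow> 'a \<times> 'g list \<Rightarrow>\<^sub>0 int) \<Rightarrow> ('a \<times> 'g list \<Rightarrow>\<^sub>0 int) \<Rightarrow> 'a \<times> 'g list \<Rightarrow>\<^sub>0 int"
  where "linear_ext \<delta> = frag_extend (\<lambda>(m, c). if c = [] then frag_of (\<one>, []) else act m (\<delta> c))"

text \<open>The boundary of a # c is a[c] minus a lighter element with the same boundary, which
  makes it a cycle. Here that element is only chosen; its existence is settled by the lemma
  \<open>bd_ok\<close>. The 0 in degree 0 is a default: the only chain there is [], which
  \<open>linear_ext\<close> treats separately.\<close>

primrec bd_chain :: "nat \<Rightarrow> 'g list \<Rightarrow> 'a \<times> 'g list \<Rightarrow>\<^sub>0 int" where
  "bd_chain 0 c = 0"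
| "bd_chain (Suc k) c = frag_of (gen (hd c), tl c) -
    (SOME y. y \<in> cell_span k \<and> light (val c) y \<and>
      linear_ext (bd_chain k) y = linear_ext (bd_chain k) (frag_of (gen (hd c), tl c)))"

definition bd :: "nat \<Rightarrow> ('a \<times> 'g list \<Rightarrow>\<^sub>0 int) \<Rightarrow> 'a \<times> 'g list \<Rightarrow>\<^sub>0 int" where
  "bd k = linear_ext (bd_chain k)"

lemma bd_simps [simp]: "bd k 0 = 0" "bd k (y - z) = bd k y - bd k z" "bd k (y + z) = bd k y + bd k z"
  by (simp_all add: bd_def linear_ext_def frag_extend_diff frag_extend_add)

lemma bd_cell: "bd k (frag_of (m, c)) = (if c = [] then frag_of (\<one>, []) else act m (bd_chain k c))"
  by (simp add: bd_def linear_ext_def)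

text \<open>The induction claim: the choice in \<open>bd_chain\<close> succeeds in this
  degree.\<close>

definition bd_ok :: "nat \<Rightarrow> bool" where
  "bd_ok k \<longleftrightarrow> (\<forall>c\<in>chains (Suc k). \<exists>y\<in>cell_span k. light (val c) y \<and>
    bd_chain (Suc k) c = frag_of (gen (hd c), tl c) - y \<and> bd k (bd_chain (Suc k) c) = 0)"

lemma bd_okI:
  assumes "\<And>c. c \<in> chains (Suc k) \<Longrightarrow>
    \<exists>y\<in>cell_span k. light (val c) y \<and> bd k y = bd k (frag_of (gen (hd c), tl c))"
  shows "bd_ok k"
  unfolding bd_ok_def
proof
  fix c assume "c \<in> chains (Suc k)"
  define y where "y = (SOME y. y \<in> cell_span k \<and> light (val c) y \<and> bd k y = bd k (frag_of (gen (hd c), tl c)))"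
  have y: "y \<in> cell_span k \<and> light (val c) y \<and> bd k y = bd k (frag_of (gen (hd c), tl c))"
    unfolding y_def by (rule someI_ex) (use assms[OF \<open>c \<in> chains (Suc k)\<close>] in blast)
  have b: "bd_chain (Suc k) c = frag_of (gen (hd c), tl c) - y"
    by (simp add: y_def bd_def)
  show "\<exists>y\<in>cell_span k. light (val c) y \<and>
    bd_chain (Suc k) c = frag_of (gen (hd c), tl c) - y \<and> bd k (bd_chain (Suc k) c) = 0"
    using y by (intro bexI[of _ y]) (simp_all add: b del: bd_chain.simps)
qed

lemma bd_chain_span:
  assumes "bd_ok k" "c \<in> chains (Suc k)"
  shows "bd_chain (Suc k) c \<in> cell_span k" "bd k (bd_chain (Suc k) c) = 0"
proof -
  obtain y where y: "y \<in> cell_span k" "bd_chain (Suc k) c = frag_of (gen (hd c), tl c) - y"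
    "bd k (bd_chain (Suc k) c) = 0"
    using assms unfolding bd_ok_def by blast
  obtain a c' where "c = a # c'" "a \<in> G" "c' \<in> chains k" by (rule chains_Suc[OF assms(2)])
  then show "bd_chain (Suc k) c \<in> cell_span k" using y by (simp add: gen_closed del: bd_chain.simps)
  show "bd k (bd_chain (Suc k) c) = 0" by fact
qed

lemma bd_Suc_cell: "c \<in> chains (Suc k) \<Longrightarrow> bd (Suc k) (frag_of (m, c)) = act m (bd_chain (Suc k) c)"
  by (auto simp: bd_cell chains_def)

lemma bd_span:
  assumes "bd_ok k" "z \<in> cell_span (Suc k)"
  shows "bd (Suc k) z \<in> cell_span k"
  using assms(2)
  by (induction z rule: cell_span_induct)
    (simp_all add: bd_Suc_cell act_span bd_chain_span[OF assms(1)] del: bd_chain.simps)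

lemma bd_act_0: "z \<in> cell_span 0 \<Longrightarrow> bd 0 (act m z) = bd 0 z"
  by (induction z rule: cell_span_induct) (simp_all add: bd_cell chains_0)

lemma bd_act_Suc:
  assumes "bd_ok k" "m \<in> carrier M" "z \<in> cell_span (Suc k)"
  shows "bd (Suc k) (act m z) = act m (bd (Suc k) z)"
  using assms(3)
  by (induction z rule: cell_span_induct)
    (simp_all add: bd_Suc_cell act_act[OF bd_chain_span(1)[OF assms(1)]] assms(2) del: bd_chain.simps)

text \<open>Boundaries of chains are cycles by construction, and linearity passes this on to all
  cells. Degree 0 is separate because \<open>bd 0\<close> is invariant under the action instead of
  linear.\<close>

lemma bd_bd:
  assumes "\<And>j. j \<le> k \<Longrightarrow> bd_ok j" "z \<in> cell_span (Suc k)"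
  shows "bd k (bd (Suc k) z) = 0"
  using assms(2)
proof (induction z rule: cell_span_induct)
  case (cell m c)
  note b = bd_chain_span[OF assms(1) cell(2), OF order_refl]
  show ?case
  proof (cases k)
    case 0
    then show ?thesis using b cell by (simp add: bd_Suc_cell bd_act_0 del: bd_chain.simps)
  next
    case (Suc j)
    then show ?thesis using b cell assms(1)[of j] by (simp add: bd_Suc_cell bd_act_Suc del: bd_chain.simps)
  qed
qed simp_all

section \<open>Triangularity of the boundary\<close>

definition lead :: "'a \<times> 'g list \<Rightarrow> 'a \<times> 'g list" where
  "lead p = (fst p \<otimes> gen (hd (snd p)), tl (snd p))"

text \<open>Translating the correction term of the chain by m keeps it below the weight of m[c], by
  \<open>light_act\<close>.\<close>

lemma bd_lead:
  assumes "bd_ok k" "p \<in> cells (Suc k)"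
  shows "\<exists>y\<in>cell_span k. light (weight p) y \<and> bd (Suc k) (frag_of p) = frag_of (lead p) - y"
proof -
  obtain m c where p: "p = (m, c)" "m \<in> carrier M" "c \<in> chains (Suc k)" using assms(2) by (cases p) auto
  obtain y where y: "y \<in> cell_span k" "light (val c) y" "bd_chain (Suc k) c = frag_of (gen (hd c), tl c) - y"
    using assms(1) p(3) unfolding bd_ok_def by blast
  have "light (val (nf m @ c)) (act (ev (nf m)) y)"
    by (rule light_act[OF y(1,2) nf(1)[OF p(2)] chains_lists[OF p(3)]])
  then have "light (weight p) (act m y)" by (simp add: weight_def p nf(2))
  moreover have "bd (Suc k) (frag_of p) = frag_of (lead p) - act m y"
    unfolding p(1) bd_Suc_cell[OF p(3)] y(3) by (simp add: lead_def)
  ultimately show ?thesis using act_span[OF p(2) y(1)] by blast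
qed

text \<open>The boundary matches the free cells of degree \<open>k + 1\<close> bijectively, through \<open>lead\<close> and
  up to terms of smaller weight, with the cells of degree \<open>k\<close> that are not free.\<close>

definition free_cell :: "'a \<times> 'g list \<Rightarrow> bool" where
  "free_cell p \<longleftrightarrow> nf (fst p) = [] \<or> (snd p \<noteq> [] \<and> good (last (nf (fst p))) (hd (snd p)))"

text \<open>Freeness says that the first letter of the chain extends the normal form to a longer
  normal word.\<close>

lemma nf_lead:
  assumes "p \<in> cells (Suc k)" "free_cell p"
  shows "nf (fst (lead p)) = nf (fst p) @ [hd (snd p)]" "hd (snd p) # snd (lead p) = snd p"
    "fst (lead p) \<in> carrier M"
proof -
  obtain m c where p: "p = (m, c)" "m \<in> carrier M" "c \<in> chains (Suc k)" using assms(1) by (cases p) auto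
  obtain a c' where c: "c = a # c'" "a \<in> G" by (rule chains_Suc[OF p(3)])
  have "normal (nf m @ [a])"
    using nf(1)[OF p(2)] assms(2) c
    by (auto simp: normal_def successively_append_iff free_cell_def p)
  moreover have "ev (nf m @ [a]) = m \<otimes> gen a"
    using ev_append[OF nf_lists[OF p(2)], of "[a]"] nf(2)[OF p(2)] c by (simp add: gen_closed)
  ultimately show "nf (fst (lead p)) = nf (fst p) @ [hd (snd p)]"
    using nf_eval by (force simp: lead_def p c)
  show "hd (snd p) # snd (lead p) = snd p" by (simp add: lead_def p c)
  show "fst (lead p) \<in> carrier M" using p(2) c(2) by (simp add: lead_def p(1) c(1) gen_closed)
qed

lemma weight_lead: "p \<in> cells (Suc k) \<Longrightarrow> free_cell p \<Longrightarrow> weight (lead p) = weight p"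
  using nf_lead[of p k] by (simp add: weight_def)

lemma inj_lead:
  assumes "p \<in> cells (Suc k)" "free_cell p" "q \<in> cells (Suc k)" "free_cell q" "lead p = lead q"
  shows "p = q"
proof -
  have "nf (fst p) = nf (fst q)" "snd p = snd q"
    using nf_lead[OF assms(1,2)] nf_lead[OF assms(3,4)] assms(5) by auto
  then show ?thesis using nf(2) assms(1,3) by (metis SigmaE fst_conv snd_conv)
qed

text \<open>Here \<open>lead\<close> is inverted: the last letter of the normal form moves into the
  chain. It extends the chain because, the cell not being free, it forms a reducible pair with the
  first letter, if there is one. The new cell is free because the letter followed the rest of a
  normal word.\<close>

lemma bound_cell:
  assumes "q \<in> cells k" "\<not> free_cell q"
  shows "\<exists>p\<in>cells (Suc k). free_cell p \<and> lead p = q \<and> weight p = weight q"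
proof -
  obtain m c where q: "q = (m, c)" "m \<in> carrier M" "c \<in> chains k" using assms(1) by (cases q) auto
  have "nf m \<noteq> []" using assms(2) by (auto simp: free_cell_def q)
  then obtain u a where ua: "nf m = u @ [a]" by (metis rev_exhaust)
  have na: "normal (u @ [a])" using nf(1)[OF q(2)] by (simp add: ua)
  then have u: "normal u" "a \<in> G" "u \<in> lists G" and good: "u = [] \<or> good (last u) a"
    by (auto simp: normal_def successively_append_iff)
  have "a # c \<in> chains (Suc k)"
    using q(3) assms(2) u ua by (auto simp: chains_def successively_Cons free_cell_def q)
  moreover have m: "ev u \<otimes> gen a = m"
    using nf(2)[OF q(2)] ev_append[OF u(3), of "[a]"] u by (simp add: ua gen_closed)
  ultimately show ?thesis using good u nf_eval[OF u(1)]
    by (intro bexI[of _ "(ev u, a # c)"]) (auto simp: free_cell_def lead_def q weight_def ua)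
qed

text \<open>Gaussian elimination by weight: a cell that is not free is the leading term of the
  boundary of its partner, so it can be traded for lighter terms. The outer induction on
  \<open>W\<close> clears these; the inner one runs over the terms of z.\<close>

lemma reduce_to_free:
  assumes "bd_ok k" "z \<in> cell_span k" "light W z"
  shows "\<exists>y\<in>cell_span (Suc k). light W y \<and> (\<forall>p\<in>Poly_Mapping.keys (z - bd (Suc k) y). free_cell p)"
  using assms(2,3)
proof (induction W arbitrary: z rule: less_induct)
  case (less W)
  have "Poly_Mapping.keys z \<subseteq> {p \<in> cells k. weight p < W}"
    using less.prems by (auto simp: cell_span_def light_def)
  then show ?case
  proof (induction z rule: frag_induction)
    case zero
    show ?case by (rule bexI[of _ 0]) auto
  next
    case (one q)
    show ?case
    proof (cases "free_cell q")
      case True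
      then show ?thesis by (intro bexI[of _ 0]) auto
    next
      case False
      then obtain p where p: "p \<in> cells (Suc k)" "lead p = q" "weight p = weight q"
        using bound_cell one by blast
      obtain y where y: "y \<in> cell_span k" "light (weight q) y" "bd (Suc k) (frag_of p) = frag_of q - y"
        using bd_lead[OF assms(1) p(1)] p by auto
      have q: "weight q < W" using one by simp
      obtain x where x: "x \<in> cell_span (Suc k)" "light (weight q) x"
        "\<forall>p\<in>Poly_Mapping.keys (y - bd (Suc k) x). free_cell p"
        using less.IH[OF q y(1,2)] by blast
      have "light W (frag_of p + x)"
        using light_mono[OF x(2), of W] q p(3) by (intro light_add) auto
      moreover have "frag_of q - bd (Suc k) (frag_of p + x) = y - bd (Suc k) x" by (simp add: y(3))
      then have "\<forall>r\<in>Poly_Mapping.keys (frag_of q - bd (Suc k) (frag_of p + x)). free_cell r"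
        using x(3) by metis
      moreover have "frag_of p + x \<in> cell_span (Suc k)"
        by (rule cell_span_add[OF cell_span_simps(2)[OF p(1)] x(1)])
      ultimately show ?thesis by blast
    qed
  next
    case (diff z z')
    then obtain y y' where y: "y \<in> cell_span (Suc k)" "light W y" "\<forall>p\<in>Poly_Mapping.keys (z - bd (Suc k) y). free_cell p"
      "y' \<in> cell_span (Suc k)" "light W y'" "\<forall>p\<in>Poly_Mapping.keys (z' - bd (Suc k) y'). free_cell p"
      by blast
    have eq: "z - z' - bd (Suc k) (y - y') = (z - bd (Suc k) y) - (z' - bd (Suc k) y')" by simp
    have "\<forall>p\<in>Poly_Mapping.keys (z - z' - bd (Suc k) (y - y')). free_cell p"
      unfolding eq using y(3,6) subsetD[OF keys_diff[of "z - bd (Suc k) y" "z' - bd (Suc k) y'"]] by blast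
    moreover have "light W (y - y')" "y - y' \<in> cell_span (Suc k)" using y by (simp_all add: light_diff)
    ultimately show ?case by blast
  qed
qed

definition bd_inj :: "nat \<Rightarrow> bool" where
  "bd_inj k \<longleftrightarrow> (\<forall>z\<in>cell_span k. (\<forall>p\<in>Poly_Mapping.keys z. free_cell p) \<longrightarrow> bd k z = 0 \<longrightarrow> z = 0)"

text \<open>The only free cell of degree 0 is \<open>(\<one>, [])\<close>, and \<open>bd 0\<close>
  fixes it.\<close>

lemma bd_inj_0: "bd_inj 0"
  unfolding bd_inj_def
proof (intro ballI impI)
  fix z assume z: "z \<in> cell_span 0" "\<forall>p\<in>Poly_Mapping.keys z. free_cell p" "bd 0 z = 0"
  have keys: "p = (\<one>, [])" if "p \<in> Poly_Mapping.keys z" for p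
  proof -
    have "p \<in> cells 0" using z(1) that by (auto simp: cell_span_def)
    then obtain m where p: "p = (m, [])" "m \<in> carrier M" by (auto simp: chains_0)
    then have "nf m = []" using z(2) that by (auto simp: free_cell_def)
    then show ?thesis using p nf(2)[OF p(2)] by simp
  qed
  have "bd 0 z = frag_extend frag_of z"
    unfolding bd_def linear_ext_def by (rule frag_extend_eq) (auto dest: keys)
  then show "z = 0" using z(3) frag_expansion[of z] by simp
qed

text \<open>The leading term of a heaviest cell p of z cannot cancel: the correction belonging to q
  is lighter than \<open>weight q \<le> weight p\<close>, and \<open>lead\<close> is injective on
  free cells. So \<open>lead p\<close> has the same coefficient in the boundary as p in z.\<close>

lemma bd_inj_Suc:
  assumes "bd_ok k"
  shows "bd_inj (Suc k)"
  unfolding bd_inj_def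
proof (intro ballI impI, rule ccontr)
  fix z assume z: "z \<in> cell_span (Suc k)" "\<forall>p\<in>Poly_Mapping.keys z. free_cell p" "bd (Suc k) z = 0" "z \<noteq> 0"
  have cells: "p \<in> cells (Suc k)" if "p \<in> Poly_Mapping.keys z" for p
    using z(1) that by (auto simp: cell_span_def)
  define w where "w = Max (weight ` Poly_Mapping.keys z)"
  have "w \<in> weight ` Poly_Mapping.keys z" unfolding w_def using z(4) by (intro Max_in) auto
  then obtain p where p: "p \<in> Poly_Mapping.keys z" "weight p = w" by auto
  have max: "weight q \<le> w" if "q \<in> Poly_Mapping.keys z" for q
    unfolding w_def using that by (intro Max_ge) auto
  have coeff: "Poly_Mapping.lookup (bd (Suc k) (frag_of q)) (lead p) = (if q = p then 1 else 0)"
    if q: "q \<in> Poly_Mapping.keys z" for q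
  proof -
    obtain y where y: "light (weight q) y" "bd (Suc k) (frag_of q) = frag_of (lead q) - y"
      using bd_lead[OF assms cells[OF q]] by blast
    have "weight (lead p) = w" using weight_lead[OF cells[OF p(1)]] z(2) p by simp
    then have "lead p \<notin> Poly_Mapping.keys y" using y(1) max[OF q] by (auto simp: light_def)
    then have "Poly_Mapping.lookup y (lead p) = 0" by (simp add: in_keys_iff)
    moreover have "lead q = lead p \<longleftrightarrow> q = p"
      using inj_lead[OF cells[OF q] _ cells[OF p(1)]] z(2) q p(1) by blast
    ultimately show ?thesis unfolding y(2) by (auto simp: lookup_minus)
  qed
  have "Poly_Mapping.lookup (bd (Suc k) z) (lead p) =
      (\<Sum>q\<in>Poly_Mapping.keys z. Poly_Mapping.lookup z q * Poly_Mapping.lookup (bd (Suc k) (frag_of q)) (lead p))"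
    unfolding bd_def linear_ext_def lookup_frag_extend by simp
  also have "\<dots> = (\<Sum>q\<in>Poly_Mapping.keys z. if q = p then Poly_Mapping.lookup z p else 0)"
    by (rule sum.cong) (auto simp: coeff)
  also have "\<dots> = Poly_Mapping.lookup z p" using p(1) by simp
  finally show False using z(3) p(1) by (simp add: in_keys_iff)
qed

text \<open>After the other cells are cleared, a cycle on free cells remains, and it vanishes
  because the boundary is injective on these. The bound on the preimage lets it serve as a
  correction term in the next degree.\<close>

lemma exact_light:
  assumes "\<And>j. j \<le> k \<Longrightarrow> bd_ok j" "z \<in> cell_span k" "bd k z = 0" "light W z"
  shows "\<exists>y\<in>cell_span (Suc k). light W y \<and> bd (Suc k) y = z"
proof -
  have ok: "bd_ok k" and inj: "bd_inj k"
    using assms(1) bd_inj_0 bd_inj_Suc by (auto, cases k, auto)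
  obtain y where y: "y \<in> cell_span (Suc k)" "light W y"
    "\<forall>p\<in>Poly_Mapping.keys (z - bd (Suc k) y). free_cell p"
    using reduce_to_free[OF ok assms(2,4)] by blast
  have "bd k (z - bd (Suc k) y) = 0" using bd_bd[OF assms(1) y(1)] assms(3) by simp
  moreover have "z - bd (Suc k) y \<in> cell_span k" using assms(2) bd_span[OF ok y(1)] by simp
  ultimately have "z - bd (Suc k) y = 0" using inj y(3) unfolding bd_inj_def by blast
  then show ?thesis using y by (intro bexI[of _ y]) auto
qed

lemma bd_ok: "bd_ok k"
proof (induction k rule: less_induct)
  case (less k)
  show ?case
  proof (rule bd_okI)
    fix c assume c: "c \<in> chains (Suc k)"
    obtain a c' where ac: "c = a # c'" "a \<in> G" "c' \<in> chains k" by (rule chains_Suc[OF c])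
    show "\<exists>y\<in>cell_span k. light (val c) y \<and> bd k y = bd k (frag_of (gen (hd c), tl c))"
    proof (cases k)
      case 0
      \<comment> \<open>The boundary of a letter a is a[] - 1[]: the correction is the cell of the
        unit, and \<open>val_Nil\<close> bounds it.\<close>
      then show ?thesis using ac
        by (intro bexI[of _ "frag_of (\<one>, [])"]) (auto simp: chains_0 bd_cell weight_def val_Nil)
    next
      case (Suc j)
      have ok: "bd_ok i" if "i \<le> j" for i using less that Suc by simp
      define b where "b = (gen a, c')"
      have b: "b \<in> cells (Suc j)" using ac Suc by (simp add: b_def gen_closed)
      obtain y where y: "y \<in> cell_span j" "light (weight b) y" "bd (Suc j) (frag_of b) = frag_of (lead b) - y"
        using bd_lead[OF ok[OF order_refl] b] by blast
      have wb: "weight b = val c" using ac by (simp add: weight_def b_def)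
      obtain a' c'' where c': "c' = a' # c''" "a' \<in> G" "c'' \<in> chains j"
        using ac(3) chains_Suc Suc by blast
      \<comment> \<open>The leading term of the boundary of \<open>b\<close> contains the product of
        the reducible pair a a', whose normal form is strictly smaller. So the whole boundary lies
        below \<open>val c\<close>, and a preimage under the same bound is the wanted
        correction.\<close>
      have ng: "\<not> good a a'" using c by (simp add: chains_def ac(1) c'(1))
      have aa: "[a, a'] \<in> lists G" using ac c' by simp
      have "nf (ev [a, a']) \<noteq> [a, a']"
        using nf(1)[of "ev [a, a']"] aa ng by (auto simp: normal_def gen_closed)
      then have "val (nf (ev [a, a'])) < val [a, a']" using val_nf[OF aa] by blast
      from val_mono[OF _ aa _ _ this, of "[]" c''] have "weight (lead b) < val c"
        using nf_lists[OF ev_closed[OF aa]] chains_lists[OF c'(3)] ac c'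
        by (simp add: weight_def lead_def b_def gen_closed)
      then have "light (val c) (bd (Suc j) (frag_of b))"
        unfolding y(3) using y(2) wb by (intro light_diff) auto
      moreover have "bd (Suc j) (frag_of b) \<in> cell_span j"
        using b by (intro bd_span ok) auto
      moreover have "bd j (bd (Suc j) (frag_of b)) = 0"
        using b by (intro bd_bd ok) auto
      ultimately obtain x where "x \<in> cell_span (Suc j)" "light (val c) x" "bd (Suc j) x = bd (Suc j) (frag_of b)"
        using exact_light[OF ok, of j] by blast
      then show ?thesis using ac by (auto simp: Suc b_def)
    qed
  qed
qed

lemma bd_exact: "bd (Suc k) ` cell_span (Suc k) = {z \<in> cell_span k. bd k z = 0}"
  using exact_light[OF bd_ok] exists_light bd_span[OF bd_ok] bd_bd[OF bd_ok] by blast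

end

section \<open>Free modules over the monoid ring\<close>

text \<open>\<open>left_FP_infty\<close> prescribes the type of the carriers, whereas the resolution
  lives on cells of a different type. Its modules are therefore carried over along
  injections.\<close>

definition transfer_module ::
  "('x \<Rightarrow> 'y) \<Rightarrow> ('r, 'x, 'n) module_scheme \<Rightarrow> ('r, 'y) module" where
  "transfer_module \<phi> N = (let \<psi> = inv_into (carrier N) \<phi> in
    \<lparr>carrier = \<phi> ` carrier N, mult = (\<lambda>u v. u), one = \<phi> \<zero>\<^bsub>N\<^esub>, zero = \<phi> \<zero>\<^bsub>N\<^esub>,
     add = (\<lambda>u v. \<phi> (\<psi> u \<oplus>\<^bsub>N\<^esub> \<psi> v)), smult = (\<lambda>a u. \<phi> (a \<odot>\<^bsub>N\<^esub> \<psi> u))\<rparr>)"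

context
  fixes R :: "('r, 'm) ring_scheme" and N :: "('r, 'x, 'n) module_scheme" and \<phi> :: "'x \<Rightarrow> 'y"
  assumes left_module: "left_module R N" and inj: "inj_on \<phi> (carrier N)"
begin

interpretation left_module R N by (rule left_module)

lemma transfer_sel:
  "carrier (transfer_module \<phi> N) = \<phi> ` carrier N"
  "\<zero>\<^bsub>transfer_module \<phi> N\<^esub> = \<phi> \<zero>\<^bsub>N\<^esub>"
  "x \<in> carrier N \<Longrightarrow> y \<in> carrier N \<Longrightarrow> \<phi> x \<oplus>\<^bsub>transfer_module \<phi> N\<^esub> \<phi> y = \<phi> (x \<oplus>\<^bsub>N\<^esub> y)"
  "x \<in> carrier N \<Longrightarrow> a \<odot>\<^bsub>transfer_module \<phi> N\<^esub> \<phi> x = \<phi> (a \<odot>\<^bsub>N\<^esub> x)"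
  by (simp_all add: transfer_module_def Let_def inv_into_f_f[OF inj])

lemma abelian_group_transfer: "abelian_group (transfer_module \<phi> N)"
proof (rule abelian_groupI)
  fix u assume "u \<in> carrier (transfer_module \<phi> N)"
  then obtain x where x: "x \<in> carrier N" "u = \<phi> x" by (auto simp: transfer_sel)
  then show "\<exists>v\<in>carrier (transfer_module \<phi> N). v \<oplus>\<^bsub>transfer_module \<phi> N\<^esub> u = \<zero>\<^bsub>transfer_module \<phi> N\<^esub>"
    by (intro bexI[of _ "\<phi> (\<ominus>\<^bsub>N\<^esub> x)"]) (auto simp: transfer_sel M.l_neg)
qed (auto simp: transfer_sel M.a_assoc M.a_comm M.add.m_lcomm)

lemma left_module_transfer: "left_module R (transfer_module \<phi> N)"
  by (intro left_module.intro left_module_axioms.intro abelian_group_transfer R.ring_axioms)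
    (auto simp: transfer_sel smult_closed smult_l_distr smult_r_distr smult_assoc smult_one)

interpretation T: abelian_group "transfer_module \<phi> N" by (rule abelian_group_transfer)

lemma finsum_transfer:
  assumes "finite A" "f \<in> A \<rightarrow> carrier N"
  shows "finsum (transfer_module \<phi> N) (\<lambda>i. \<phi> (f i)) A = \<phi> (finsum N f A)"
  using assms
proof (induction A rule: finite_induct)
  case (insert i A)
  then show ?case by (subst T.finsum_insert) (auto simp: transfer_sel M.finsum_insert)
qed (simp add: transfer_sel)

lemma combination_transfer:
  assumes "finite B" "B \<subseteq> carrier N" "c \<in> B \<rightarrow> carrier R" "\<And>b. b \<in> B \<Longrightarrow> c' (\<phi> b) = c b"
  shows "(\<Oplus>\<^bsub>transfer_module \<phi> N\<^esub>v\<in>\<phi> ` B. c' v \<odot>\<^bsub>transfer_module \<phi> N\<^esub> v) = \<phi> (\<Oplus>\<^bsub>N\<^esub>b\<in>B. c b \<odot>\<^bsub>N\<^esub> b)"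
proof -
  have injB: "inj_on \<phi> B" using inj assms(2) by (rule inj_on_subset)
  have cl: "c b \<odot>\<^bsub>N\<^esub> b \<in> carrier N" if "b \<in> B" for b
    using that assms(2,3) by (auto intro: smult_closed)
  have eq: "c' (\<phi> b) \<odot>\<^bsub>transfer_module \<phi> N\<^esub> \<phi> b = \<phi> (c b \<odot>\<^bsub>N\<^esub> b)" if "b \<in> B" for b
    using that assms(2,4) by (auto simp: transfer_sel)
  have "(\<Oplus>\<^bsub>transfer_module \<phi> N\<^esub>v\<in>\<phi> ` B. c' v \<odot>\<^bsub>transfer_module \<phi> N\<^esub> v) =
      (\<Oplus>\<^bsub>transfer_module \<phi> N\<^esub>b\<in>B. c' (\<phi> b) \<odot>\<^bsub>transfer_module \<phi> N\<^esub> \<phi> b)"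
    using injB eq cl by (intro T.finsum_reindex) (auto simp: transfer_sel(1))
  also have "\<dots> = (\<Oplus>\<^bsub>transfer_module \<phi> N\<^esub>b\<in>B. \<phi> (c b \<odot>\<^bsub>N\<^esub> b))"
    using eq cl by (intro T.finsum_cong') (auto simp: transfer_sel(1))
  also have "\<dots> = \<phi> (\<Oplus>\<^bsub>N\<^esub>b\<in>B. c b \<odot>\<^bsub>N\<^esub> b)"
    using assms(1) cl by (intro finsum_transfer) auto
  finally show ?thesis .
qed

lemma module_basis_transfer:
  assumes "module_basis R N B"
  shows "module_basis R (transfer_module \<phi> N) (\<phi> ` B)"
proof -
  have B: "finite B" "B \<subseteq> carrier N"
    and ex: "\<And>x. x \<in> carrier N \<Longrightarrow> \<exists>!c. c \<in> B \<rightarrow>\<^sub>E carrier R \<and> x = (\<Oplus>\<^bsub>N\<^esub>b\<in>B. c b \<odot>\<^bsub>N\<^esub> b)"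
    using assms by (auto simp: module_basis_def)
  define \<psi> where "\<psi> = inv_into (carrier N) \<phi>"
  have \<psi>: "\<psi> (\<phi> x) = x" if "x \<in> carrier N" for x using that inj by (simp add: \<psi>_def)
  have comb_cl: "(\<Oplus>\<^bsub>N\<^esub>b\<in>B. c b \<odot>\<^bsub>N\<^esub> b) \<in> carrier N" if "c \<in> B \<rightarrow>\<^sub>E carrier R" for c
    using that B by (intro M.finsum_closed) (auto intro!: smult_closed)
  have "\<exists>!c'. c' \<in> \<phi> ` B \<rightarrow>\<^sub>E carrier R \<and>
      \<phi> x = (\<Oplus>\<^bsub>transfer_module \<phi> N\<^esub>v\<in>\<phi> ` B. c' v \<odot>\<^bsub>transfer_module \<phi> N\<^esub> v)"
    if x: "x \<in> carrier N" for x
  proof -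
    obtain c where c: "c \<in> B \<rightarrow>\<^sub>E carrier R" "x = (\<Oplus>\<^bsub>N\<^esub>b\<in>B. c b \<odot>\<^bsub>N\<^esub> b)"
      and uniq: "\<And>c'. c' \<in> B \<rightarrow>\<^sub>E carrier R \<Longrightarrow> x = (\<Oplus>\<^bsub>N\<^esub>b\<in>B. c' b \<odot>\<^bsub>N\<^esub> b) \<Longrightarrow> c' = c"
      using ex[OF x] by blast
    show ?thesis
    proof (rule ex1I[of _ "restrict (c \<circ> \<psi>) (\<phi> ` B)"], intro conjI)
      show "restrict (c \<circ> \<psi>) (\<phi> ` B) \<in> \<phi> ` B \<rightarrow>\<^sub>E carrier R"
        using c(1) \<psi>[OF subsetD[OF B(2)]] by auto
      show "\<phi> x = (\<Oplus>\<^bsub>transfer_module \<phi> N\<^esub>v\<in>\<phi> ` B. restrict (c \<circ> \<psi>) (\<phi> ` B) v \<odot>\<^bsub>transfer_module \<phi> N\<^esub> v)"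
        unfolding c(2) by (rule combination_transfer[symmetric]) (use c(1) B \<psi> in auto)
    next
      fix c' assume c': "c' \<in> \<phi> ` B \<rightarrow>\<^sub>E carrier R \<and>
        \<phi> x = (\<Oplus>\<^bsub>transfer_module \<phi> N\<^esub>v\<in>\<phi> ` B. c' v \<odot>\<^bsub>transfer_module \<phi> N\<^esub> v)"
      \<comment> \<open>Coefficient families in \<open>module_basis\<close> are extensional, so the
        family pulled back along \<phi> is cut off outside \<open>B\<close>.\<close>
      define c0 where "c0 = restrict (c' \<circ> \<phi>) B"
      have c0: "c0 \<in> B \<rightarrow>\<^sub>E carrier R" using c' by (auto simp: c0_def)
      have "c0 \<in> B \<rightarrow> carrier R" using c0 by (simp add: PiE_def)
      from combination_transfer[OF B this, of c']
      have "\<phi> x = \<phi> (\<Oplus>\<^bsub>N\<^esub>b\<in>B. c0 b \<odot>\<^bsub>N\<^esub> b)" using c' by (simp add: c0_def)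
      then have "x = (\<Oplus>\<^bsub>N\<^esub>b\<in>B. c0 b \<odot>\<^bsub>N\<^esub> b)"
        using inj x comb_cl[OF c0] by (simp add: inj_on_eq_iff)
      then have "c0 = c" using uniq c0 by blast
      then show "c' = restrict (c \<circ> \<psi>) (\<phi> ` B)"
        using c' B(2) \<psi> by (intro extensionalityI[of _ "\<phi> ` B"]) (auto simp: c0_def PiE_def subset_iff)
    qed
  qed
  then show ?thesis using B by (auto simp: module_basis_def transfer_sel(1))
qed

lemma fg_free_transfer: "fg_free R N \<Longrightarrow> fg_free R (transfer_module \<phi> N)"
  using module_basis_transfer by (auto simp: fg_free_def)

end

lemma fg_free_resolution_transfer:
  fixes F :: "nat \<Rightarrow> ('r, 'x, 'n) module_scheme" and \<phi> :: "nat \<Rightarrow> 'x \<Rightarrow> 'y"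
  assumes res: "fg_free_resolution R F d e N"
    and mod: "\<And>i. left_module R (F i)" and inj: "\<And>i. inj_on (\<phi> i) (carrier (F i))"
  defines "\<psi> \<equiv> \<lambda>i. inv_into (carrier (F i)) (\<phi> i)"
  shows "fg_free_resolution R (\<lambda>i. transfer_module (\<phi> i) (F i))
    (\<lambda>i. \<phi> i \<circ> d i \<circ> \<psi> (Suc i)) (e \<circ> \<psi> 0) N"
proof -
  have \<psi>: "\<psi> i (\<phi> i x) = x" if "x \<in> carrier (F i)" for i x
    using that inj[of i] by (simp add: \<psi>_def)
  note sel = transfer_sel[OF mod inj]
  have d: "\<And>i. d i \<in> module_hom R (F (Suc i)) (F i)" and e: "e \<in> module_hom R (F 0) N"
    and free: "\<And>i. fg_free R (F i)"
    and ex: "e ` carrier (F 0) = carrier N" "d 0 ` carrier (F 1) = a_kernel (F 0) N e"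
      "\<And>i. d (Suc i) ` carrier (F (Suc (Suc i))) = a_kernel (F (Suc i)) (F i) (d i)"
    using res by (auto simp: fg_free_resolution_def)
  have dcl: "d i x \<in> carrier (F i)" if "x \<in> carrier (F (Suc i))" for i x
    using d[of i] that by (auto simp: module_hom_def)
  have zero: "\<zero>\<^bsub>F i\<^esub> \<in> carrier (F i)" for i
  proof -
    interpret left_module R "F i" by (rule mod)
    show ?thesis by simp
  qed
  have closed: "x \<oplus>\<^bsub>F i\<^esub> y \<in> carrier (F i)" "a \<in> carrier R \<Longrightarrow> a \<odot>\<^bsub>F i\<^esub> x \<in> carrier (F i)"
    if "x \<in> carrier (F i)" "y \<in> carrier (F i)" for i x y a
  proof -
    interpret left_module R "F i" by (rule mod)
    show "x \<oplus>\<^bsub>F i\<^esub> y \<in> carrier (F i)" "a \<in> carrier R \<Longrightarrow> a \<odot>\<^bsub>F i\<^esub> x \<in> carrier (F i)"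
      using that by (auto intro: smult_closed)
  qed
  have img: "(\<phi> i \<circ> d i \<circ> \<psi> (Suc i)) ` carrier (transfer_module (\<phi> (Suc i)) (F (Suc i))) =
      \<phi> i ` d i ` carrier (F (Suc i))" for i
    by (simp add: sel image_image \<psi>)
  have ker: "a_kernel (transfer_module (\<phi> 0) (F 0)) N (e \<circ> \<psi> 0) = \<phi> 0 ` a_kernel (F 0) N e"
    by (auto simp: a_kernel_def' sel \<psi>)
  have ker': "a_kernel (transfer_module (\<phi> (Suc i)) (F (Suc i))) (transfer_module (\<phi> i) (F i))
      (\<phi> i \<circ> d i \<circ> \<psi> (Suc i)) = \<phi> (Suc i) ` a_kernel (F (Suc i)) (F i) (d i)" for i
    by (auto simp: a_kernel_def' sel \<psi> inj_on_eq_iff[OF inj dcl zero])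
  show ?thesis
    unfolding fg_free_resolution_def
  proof (intro conjI allI)
    show "fg_free R (transfer_module (\<phi> i) (F i))" for i
      by (rule fg_free_transfer[OF mod inj free])
    show "\<phi> i \<circ> d i \<circ> \<psi> (Suc i) \<in>
        module_hom R (transfer_module (\<phi> (Suc i)) (F (Suc i))) (transfer_module (\<phi> i) (F i))" for i
      using d[of i] by (auto simp: module_hom_def sel \<psi> dcl closed)
    show "e \<circ> \<psi> 0 \<in> module_hom R (transfer_module (\<phi> 0) (F 0)) N"
      using e by (auto simp: module_hom_def sel \<psi> closed)
    show "(e \<circ> \<psi> 0) ` carrier (transfer_module (\<phi> 0) (F 0)) = carrier N"
      using ex(1) by (simp add: sel image_image \<psi>)
    show "(\<phi> 0 \<circ> d 0 \<circ> \<psi> (Suc 0)) ` carrier (transfer_module (\<phi> 1) (F 1)) =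
        a_kernel (transfer_module (\<phi> 0) (F 0)) N (e \<circ> \<psi> 0)"
      using ex(2) unfolding ker by (simp add: img[of 0, simplified])
    show "(\<phi> (Suc i) \<circ> d (Suc i) \<circ> \<psi> (Suc (Suc i))) ` carrier (transfer_module (\<phi> (Suc (Suc i))) (F (Suc (Suc i)))) =
        a_kernel (transfer_module (\<phi> (Suc i)) (F (Suc i))) (transfer_module (\<phi> i) (F i)) (\<phi> i \<circ> d i \<circ> \<psi> (Suc i))" for i
      unfolding ker' img ex(3) ..
  qed
qed

section \<open>The free module on a set of cells\<close>

definition free_module :: "('a, 'm) monoid_scheme \<Rightarrow> 'c set \<Rightarrow> ('a \<Rightarrow>\<^sub>0 int, 'a \<times> 'c \<Rightarrow>\<^sub>0 int) module" where
  "free_module M C =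
    \<lparr>carrier = {z. Poly_Mapping.keys z \<subseteq> carrier M \<times> C}, mult = (\<lambda>y z. y), one = 0, zero = 0, add = (+),
     smult = (\<lambda>f z. frag_extend (\<lambda>m. left_act M m z) f)\<rparr>"

lemma free_module_sel:
  "carrier (free_module M C) = {z. Poly_Mapping.keys z \<subseteq> carrier M \<times> C}"
  "\<zero>\<^bsub>free_module M C\<^esub> = 0"
  "y \<oplus>\<^bsub>free_module M C\<^esub> z = y + z"
  by (simp_all add: free_module_def)

lemma free_module_smult:
  "frag_of m \<odot>\<^bsub>free_module M C\<^esub> z = left_act M m z"
  "(f + g) \<odot>\<^bsub>free_module M C\<^esub> z = f \<odot>\<^bsub>free_module M C\<^esub> z + g \<odot>\<^bsub>free_module M C\<^esub> z"
  "(f - g) \<odot>\<^bsub>free_module M C\<^esub> z = f \<odot>\<^bsub>free_module M C\<^esub> z - g \<odot>\<^bsub>free_module M C\<^esub> z"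
  "f \<odot>\<^bsub>free_module M C\<^esub> (y + z) = f \<odot>\<^bsub>free_module M C\<^esub> y + f \<odot>\<^bsub>free_module M C\<^esub> z"
  "f \<odot>\<^bsub>free_module M C\<^esub> (y - z) = f \<odot>\<^bsub>free_module M C\<^esub> y - f \<odot>\<^bsub>free_module M C\<^esub> z"
  "0 \<odot>\<^bsub>free_module M C\<^esub> z = 0"
  "f \<odot>\<^bsub>free_module M C\<^esub> 0 = 0"
  by (simp_all add: free_module_def frag_extend_diff frag_extend_add frag_extend_pointwise_diff
      frag_extend_pointwise_add frag_extend_pointwise_zero)

context
  fixes M :: "('a, 'm) monoid_scheme" and C :: "'c set"
  assumes monoid: "monoid M"
begin

interpretation monoid M by (rule monoid)

lemma keys_left_act:
  "m \<in> carrier M \<Longrightarrow> Poly_Mapping.keys z \<subseteq> carrier M \<times> C \<Longrightarrow> Poly_Mapping.keys (left_act M m z) \<subseteq> carrier M \<times> C"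
  unfolding left_act_def by (rule order_trans[OF keys_frag_extend]) auto

lemma keys_free_module_smult:
  "Poly_Mapping.keys f \<subseteq> carrier M \<Longrightarrow> Poly_Mapping.keys z \<subseteq> carrier M \<times> C \<Longrightarrow>
    Poly_Mapping.keys (f \<odot>\<^bsub>free_module M C\<^esub> z) \<subseteq> carrier M \<times> C"
  unfolding free_module_def
  by simp (rule order_trans[OF keys_frag_extend], use keys_left_act in blast)

lemma left_act_left_act:
  assumes "Poly_Mapping.keys z \<subseteq> carrier M \<times> C" "m \<in> carrier M" "m' \<in> carrier M"
  shows "left_act M m (left_act M m' z) = left_act M (m \<otimes>\<^bsub>M\<^esub> m') z"
  using assms(1) by (induction z rule: frag_induction) (auto simp: m_assoc assms)

lemma left_act_one:
  assumes "Poly_Mapping.keys z \<subseteq> carrier M \<times> C"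
  shows "left_act M \<one>\<^bsub>M\<^esub> z = z"
  using assms by (induction z rule: frag_induction) auto

lemma free_module_smult_assoc:
  assumes "Poly_Mapping.keys f \<subseteq> carrier M" "Poly_Mapping.keys g \<subseteq> carrier M"
    "Poly_Mapping.keys z \<subseteq> carrier M \<times> C"
  shows "(f \<otimes>\<^bsub>monoid_ring M\<^esub> g) \<odot>\<^bsub>free_module M C\<^esub> z = f \<odot>\<^bsub>free_module M C\<^esub> (g \<odot>\<^bsub>free_module M C\<^esub> z)"
proof -
  have "(frag_of m \<otimes>\<^bsub>monoid_ring M\<^esub> g) \<odot>\<^bsub>free_module M C\<^esub> z = frag_of m \<odot>\<^bsub>free_module M C\<^esub> (g \<odot>\<^bsub>free_module M C\<^esub> z)"
    if "m \<in> carrier M" for m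
    using assms(2)
    by (induction g rule: frag_induction)
      (simp_all add: monoid_ring_mult free_module_smult that left_act_left_act[OF assms(3)])
  with assms(1) show ?thesis
    by (induction f rule: frag_induction) (simp_all add: monoid_ring_mult free_module_smult)
qed

lemma left_module_free_module: "left_module (monoid_ring M) (free_module M C)"
proof (intro left_module.intro left_module_axioms.intro ring_monoid_ring monoid)
  have ad: "Poly_Mapping.keys (x + y) \<subseteq> carrier M \<times> C"
    if "Poly_Mapping.keys x \<subseteq> carrier M \<times> C" "Poly_Mapping.keys y \<subseteq> carrier M \<times> C" for x y :: "'a \<times> 'c \<Rightarrow>\<^sub>0 int"
    using keys_add[of x y] that by blast
  have neg: "\<exists>y\<in>carrier (free_module M C). y \<oplus>\<^bsub>free_module M C\<^esub> x = \<zero>\<^bsub>free_module M C\<^esub>"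
    if "x \<in> carrier (free_module M C)" for x
    using that by (intro bexI[of _ "- x"]) (auto simp: free_module_sel)
  show "abelian_group (free_module M C)"
    by (rule abelian_groupI) (use neg ad in \<open>auto simp: free_module_sel ac_simps\<close>)
qed (simp_all add: free_module_sel monoid_ring_sel free_module_smult keys_free_module_smult
    free_module_smult_assoc left_act_one)

text \<open>The coordinate at the basis vector c, an element of \<int>M. Coordinates provide the
  coefficients of an expansion and, being additive, also show that they are unique.\<close>

definition component :: "'c \<Rightarrow> ('a \<times> 'c \<Rightarrow>\<^sub>0 int) \<Rightarrow> 'a \<Rightarrow>\<^sub>0 int" where
  "component c = frag_extend (\<lambda>(m, c'). if c' = c then frag_of m else 0)"

lemma component_simps:
  "component c 0 = 0" "component c (frag_of (m, c')) = (if c' = c then frag_of m else 0)"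
  "component c (y - z) = component c y - component c z"
  by (simp_all add: component_def frag_extend_diff)

lemma keys_component:
  "Poly_Mapping.keys z \<subseteq> carrier M \<times> C \<Longrightarrow> Poly_Mapping.keys (component c z) \<subseteq> carrier M"
  unfolding component_def by (rule order_trans[OF keys_frag_extend]) (auto split: if_splits)

lemma lookup_component: "Poly_Mapping.lookup (component c z) m = Poly_Mapping.lookup z (m, c)"
  using subset_UNIV
  by (induction z rule: frag_induction) (auto simp: component_simps lookup_minus split: if_splits)

lemma component_smult_one:
  assumes "Poly_Mapping.keys f \<subseteq> carrier M"
  shows "component c (f \<odot>\<^bsub>free_module M C\<^esub> frag_of (\<one>\<^bsub>M\<^esub>, c')) = (if c' = c then f else 0)"
  using assms by (induction f rule: frag_induction) (auto simp: component_simps free_module_smult)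

lemma finsum_free_module:
  assumes "finite A" "f \<in> A \<rightarrow> carrier (free_module M C)"
  shows "finsum (free_module M C) f A = sum f A"
proof -
  interpret left_module "monoid_ring M" "free_module M C" by (rule left_module_free_module)
  show ?thesis using assms
    by (induction A rule: finite_induct) (auto simp: free_module_sel M.finsum_insert)
qed

lemma module_basis_free_module:
  assumes "finite C"
  shows "module_basis (monoid_ring M) (free_module M C) ((\<lambda>c. frag_of (\<one>\<^bsub>M\<^esub>, c)) ` C)"
proof -
  let ?b = "\<lambda>c. frag_of (\<one>\<^bsub>M\<^esub>, c) :: 'a \<times> 'c \<Rightarrow>\<^sub>0 int"
  let ?R = "monoid_ring M" and ?N = "free_module M C"
  have inj: "inj_on ?b C" by (auto simp: inj_on_def frag_of_eq)
  have B: "?b ` C \<subseteq> carrier ?N" by (auto simp: free_module_sel)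
  have comb: "(\<Oplus>\<^bsub>?N\<^esub>b\<in>?b ` C. f b \<odot>\<^bsub>?N\<^esub> b) = (\<Sum>c\<in>C. f (?b c) \<odot>\<^bsub>?N\<^esub> ?b c)"
    if "f \<in> ?b ` C \<rightarrow> carrier ?R" for f
  proof -
    have "f b \<odot>\<^bsub>?N\<^esub> b \<in> carrier ?N" if "b \<in> ?b ` C" for b
    proof -
      have "b \<in> carrier ?N" "f b \<in> carrier ?R" using that B \<open>f \<in> ?b ` C \<rightarrow> carrier ?R\<close> by auto
      then show ?thesis
        using keys_free_module_smult[of "f b" b] by (simp add: free_module_sel monoid_ring_sel)
    qed
    then have "(\<Oplus>\<^bsub>?N\<^esub>b\<in>?b ` C. f b \<odot>\<^bsub>?N\<^esub> b) = (\<Sum>b\<in>?b ` C. f b \<odot>\<^bsub>?N\<^esub> b)"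
      using assms by (intro finsum_free_module) auto
    then show ?thesis by (simp add: sum.reindex[OF inj])
  qed
  have expand: "z = (\<Sum>c\<in>C. component c z \<odot>\<^bsub>?N\<^esub> ?b c)" if "Poly_Mapping.keys z \<subseteq> carrier M \<times> C" for z
    using that
  proof (induction z rule: frag_induction)
    case (one p)
    then obtain m c where p: "p = (m, c)" "m \<in> carrier M" "c \<in> C" by auto
    have "(\<Sum>c'\<in>C. component c' (frag_of p) \<odot>\<^bsub>?N\<^esub> ?b c') = (\<Sum>c'\<in>C. if c' = c then frag_of p else 0)"
      by (rule sum.cong) (auto simp: p component_simps free_module_smult)
    then show ?case using p(3) assms by simp
  qed (simp_all add: component_simps free_module_smult sum_subtractf)
  have "\<exists>!f. f \<in> ?b ` C \<rightarrow>\<^sub>E carrier ?R \<and> z = (\<Oplus>\<^bsub>?N\<^esub>b\<in>?b ` C. f b \<odot>\<^bsub>?N\<^esub> b)"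
    if z: "z \<in> carrier ?N" for z
  proof -
    have zk: "Poly_Mapping.keys z \<subseteq> carrier M \<times> C" using z by (simp add: free_module_sel)
    define f where "f = restrict (\<lambda>b. component (inv_into C ?b b) z) (?b ` C)"
    have fb: "f (?b c) = component c z" if "c \<in> C" for c
      using that inv_into_f_f[OF inj] by (simp add: f_def)
    have fE: "f \<in> ?b ` C \<rightarrow>\<^sub>E carrier ?R"
      using keys_component[OF zk] by (auto simp: f_def monoid_ring_sel)
    have "z = (\<Oplus>\<^bsub>?N\<^esub>b\<in>?b ` C. f b \<odot>\<^bsub>?N\<^esub> b)"
      using expand[OF zk] comb[of f] fE by (auto simp: fb)
    moreover have "g = f" if g: "g \<in> ?b ` C \<rightarrow>\<^sub>E carrier ?R" "z = (\<Oplus>\<^bsub>?N\<^esub>b\<in>?b ` C. g b \<odot>\<^bsub>?N\<^esub> b)" for g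
    proof (rule extensionalityI[of _ "?b ` C"])
      fix b assume "b \<in> ?b ` C"
      then obtain c where c: "c \<in> C" "b = ?b c" by blast
      have gk: "Poly_Mapping.keys (g (?b c')) \<subseteq> carrier M" if "c' \<in> C" for c'
        using g(1) that by (auto simp: monoid_ring_sel PiE_def Pi_def)
      have "z = (\<Sum>c\<in>C. g (?b c) \<odot>\<^bsub>?N\<^esub> ?b c)" using g comb[of g] by auto
      then have "component c z = (\<Sum>c'\<in>C. component c (g (?b c') \<odot>\<^bsub>?N\<^esub> ?b c'))"
        using assms by (simp add: component_def frag_extend_sum)
      also have "\<dots> = (\<Sum>c'\<in>C. if c' = c then g (?b c) else 0)"
        by (rule sum.cong) (auto simp: component_smult_one[OF gk])
      finally show "g b = f b" using c assms by (simp add: fb)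
    qed (use g(1) fE in \<open>auto simp: PiE_def\<close>)
    ultimately show ?thesis using fE by blast
  qed
  then show ?thesis using assms B by (simp add: module_basis_def)
qed

text \<open>Embeds the module into sequences over \<int>M by listing coordinates along e. Covering C
  is enough: repetitions and values outside C do no harm.\<close>

lemma inj_free_module:
  assumes "C \<subseteq> range e"
  shows "inj_on (\<lambda>z j. component (e j) z) (carrier (free_module M C))"
proof (rule inj_onI)
  fix y z assume yz: "y \<in> carrier (free_module M C)" "z \<in> carrier (free_module M C)"
    and eq: "(\<lambda>j. component (e j) y) = (\<lambda>j. component (e j) z)"
  show "y = z"
  proof (rule poly_mapping_eqI)
    fix p :: "'a \<times> 'c"
    obtain m c where p: "p = (m, c)" by (cases p)
    show "Poly_Mapping.lookup y p = Poly_Mapping.lookup z p"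
    proof (cases "c \<in> C")
      case True
      then obtain j where "e j = c" using assms by blast
      then have "component c y = component c z" using fun_cong[OF eq, of j] by simp
      then show ?thesis unfolding p by (metis lookup_component)
    next
      case False
      then have "p \<notin> Poly_Mapping.keys y" "p \<notin> Poly_Mapping.keys z"
        using yz by (auto simp: free_module_sel p)
      then show ?thesis by (simp add: in_keys_iff)
    qed
  qed
qed

end

lemma left_FP_inftyI:
  fixes F :: "nat \<Rightarrow> ('a \<Rightarrow>\<^sub>0 int, 'x) module"
  assumes "\<And>i. left_module (monoid_ring M) (F i)"
    and "fg_free_resolution (monoid_ring M) F d e trivial_module"
    and "\<And>i. inj_on (\<phi> i :: 'x \<Rightarrow> nat \<Rightarrow> 'a \<Rightarrow>\<^sub>0 int) (carrier (F i))"
  shows "left_FP_infty M"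
  unfolding left_FP_infty_def
  by (intro exI conjI allI) (rule left_module_transfer[OF assms(1,3)],
      rule fg_free_resolution_transfer[OF assms(2,1,3)])

section \<open>The cells as a resolution of the trivial module\<close>

context quadratic_system
begin

lemma cell_span_free_module: "carrier (free_module M (chains k)) = cell_span k"
  by (simp add: free_module_sel cell_span_def)

lemma bd_smult:
  assumes "Poly_Mapping.keys f \<subseteq> carrier M" "z \<in> cell_span (Suc k)"
  shows "bd (Suc k) (f \<odot>\<^bsub>free_module M (chains (Suc k))\<^esub> z) = f \<odot>\<^bsub>free_module M (chains k)\<^esub> bd (Suc k) z"
  using assms(1)
  by (induction f rule: frag_induction) (simp_all add: free_module_smult bd_act_Suc[OF bd_ok _ assms(2)])

lemma bd_hom: "bd (Suc k) \<in> module_hom (monoid_ring M) (free_module M (chains (Suc k))) (free_module M (chains k))"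
  using bd_span[OF bd_ok] bd_smult
  by (auto simp: module_hom_def cell_span_free_module free_module_sel(3) monoid_ring_sel)

text \<open>Extracts the integer that \<open>bd 0\<close> stores as a multiple of
  \<open>(\<one>, [])\<close>, which gives a map into the trivial module with the same kernel on
  cells of degree 0.\<close>

definition aug :: "('a \<times> 'g list \<Rightarrow>\<^sub>0 int) \<Rightarrow> int" where
  "aug z = Poly_Mapping.lookup (bd 0 z) (\<one>, [])"

lemma aug_simps: "aug 0 = 0" "aug (y - z) = aug y - aug z" "aug (y + z) = aug y + aug z"
  by (simp_all add: aug_def lookup_minus lookup_add)

lemma bd_0_aug: "z \<in> cell_span 0 \<Longrightarrow> bd 0 z = frag_cmul (aug z) (frag_of (\<one>, []))"
  by (induction z rule: cell_span_induct)
    (simp_all add: aug_simps frag_cmul_diff_distrib, simp add: aug_def bd_cell chains_0)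

lemma aug_smult:
  assumes "Poly_Mapping.keys f \<subseteq> carrier M" "z \<in> cell_span 0"
  shows "aug (f \<odot>\<^bsub>free_module M (chains 0)\<^esub> z) = augmentation f * aug z"
  using assms(1)
proof (induction f rule: frag_induction)
  case zero
  show ?case by (simp add: free_module_smult aug_simps augmentation_def)
next
  case (one m)
  then show ?case using assms(2) by (simp add: free_module_smult augmentation_frag_of aug_def bd_act_0)
qed (simp add: free_module_smult aug_simps augmentation_diff left_diff_distrib)

lemma aug_hom: "aug \<in> module_hom (monoid_ring M) (free_module M (chains 0)) trivial_module"
  by (auto simp: module_hom_def cell_span_free_module free_module_sel(3) monoid_ring_sel
      trivial_module_def aug_simps aug_smult)

lemma aug_surj: "aug ` cell_span 0 = UNIV"
proof -
  have "aug (frag_cmul n (frag_of (\<one>, []))) = n" for n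
    by (simp add: aug_def bd_def linear_ext_def frag_extend_cmul)
  moreover have "frag_cmul n (frag_of (\<one>, [])) \<in> cell_span 0" for n
    using keys_cmul[of n "frag_of (\<one>, [])"] by (auto simp: cell_span_def chains_0)
  ultimately show ?thesis by (metis UNIV_eq_I imageI)
qed

theorem left_FP_infty: "left_FP_infty M"
proof -
  have "\<exists>e :: nat \<Rightarrow> 'g list. chains k \<subseteq> range e" for k
  proof -
    from finite_imp_nat_seg_image_inj_on[OF finite_chains[of k]]
    obtain l and e :: "nat \<Rightarrow> 'g list" where "chains k = e ` {i. i < l}" by auto
    then have "chains k \<subseteq> range e" by auto
    then show "\<exists>e :: nat \<Rightarrow> 'g list. chains k \<subseteq> range e" by (rule exI[of "\<lambda>e. chains k \<subseteq> range e" e])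
  qed
  then obtain enum :: "nat \<Rightarrow> nat \<Rightarrow> 'g list" where enum: "\<And>k. chains k \<subseteq> range (enum k)" by metis
  show ?thesis
  proof (rule left_FP_inftyI[where F = "\<lambda>k. free_module M (chains k)" and d = "\<lambda>k. bd (Suc k)" and e = aug
        and \<phi> = "\<lambda>k z j. component (enum k j) z"])
  show "left_module (monoid_ring M) (free_module M (chains k))" for k
    by (rule left_module_free_module[OF monoid_axioms])
  show "inj_on (\<lambda>z j. component (enum k j) z) (carrier (free_module M (chains k)))" for k
    by (rule inj_free_module[OF monoid_axioms enum])
  have "a_kernel (free_module M (chains 0)) (trivial_module :: ('a \<Rightarrow>\<^sub>0 int, int) module) aug = {z \<in> cell_span 0. bd 0 z = 0}"
    by (auto simp: a_kernel_def' cell_span_free_module trivial_module_def bd_0_aug)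
  moreover have "a_kernel (free_module M (chains (Suc k))) (free_module M (chains k)) (bd (Suc k)) =
      {z \<in> cell_span (Suc k). bd (Suc k) z = 0}" for k
    by (auto simp: a_kernel_def' cell_span_free_module free_module_sel(2))
  moreover have "fg_free (monoid_ring M) (free_module M (chains k))" for k
    unfolding fg_free_def by (rule exI, rule module_basis_free_module[OF monoid_axioms finite_chains])
  ultimately show "fg_free_resolution (monoid_ring M) (\<lambda>k. free_module M (chains k)) (\<lambda>k. bd (Suc k)) aug trivial_module"
    unfolding fg_free_resolution_def
    using bd_hom aug_hom aug_surj bd_exact by (simp add: cell_span_free_module trivial_module_def)
  qed
qed

end

section \<open>The opposite monoid\<close>

definition opposite_monoid :: "('a, 'm) monoid_scheme \<Rightarrow> ('a, 'm) monoid_scheme" where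
  "opposite_monoid M = M\<lparr>mult := \<lambda>x y. y \<otimes>\<^bsub>M\<^esub> x\<rparr>"

lemma opposite_monoid_sel [simp]:
  "carrier (opposite_monoid M) = carrier M" "\<one>\<^bsub>opposite_monoid M\<^esub> = \<one>\<^bsub>M\<^esub>"
  "x \<otimes>\<^bsub>opposite_monoid M\<^esub> y = y \<otimes>\<^bsub>M\<^esub> x"
  by (simp_all add: opposite_monoid_def)

lemma monoid_opposite_monoid: "monoid M \<Longrightarrow> monoid (opposite_monoid M)"
proof -
  assume "monoid M"
  then interpret monoid M .
  show ?thesis by (rule monoidI) (simp_all add: m_assoc)
qed

lemma monoid_ring_opposite_mult:
  "f \<otimes>\<^bsub>monoid_ring (opposite_monoid M)\<^esub> g = g \<otimes>\<^bsub>monoid_ring M\<^esub> f"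
proof -
  have "frag_of x \<otimes>\<^bsub>monoid_ring (opposite_monoid M)\<^esub> g = g \<otimes>\<^bsub>monoid_ring M\<^esub> frag_of x" for x
    using subset_UNIV by (induction g rule: frag_induction) (simp_all add: monoid_ring_mult)
  with subset_UNIV show ?thesis
    by (induction f rule: frag_induction) (simp_all add: monoid_ring_mult(2-))
qed

text \<open>The monoid ring of the opposite monoid is the opposite ring, so its left associativity
  law is the right one over \<int>M; the module itself does not change.\<close>

lemma right_module_opposite:
  assumes "monoid M" "left_module (monoid_ring (opposite_monoid M)) N"
  shows "right_module (monoid_ring M) N"
proof -
  interpret left_module "monoid_ring (opposite_monoid M)" N by fact
  note eqs = smult_closed smult_l_distr smult_r_distr smult_assoc smult_one
  show ?thesis
    by (intro right_module.intro right_module_axioms.intro ring_monoid_ring assms(1) M.abelian_group_axioms)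
      (use eqs in \<open>simp_all add: monoid_ring_sel monoid_ring_opposite_mult\<close>)
qed

text \<open>Bases and homomorphisms see the ring only through its carrier and the scalar action, so
  a resolution cannot tell \<int>M from its opposite.\<close>

lemma fg_free_resolution_carrier_cong:
  "carrier R = carrier S \<Longrightarrow> fg_free_resolution R F d e N \<longleftrightarrow> fg_free_resolution S F d e N"
  by (simp add: fg_free_resolution_def fg_free_def module_basis_def module_hom_def)

lemma right_FP_infty_opposite:
  assumes "monoid M" "left_FP_infty (opposite_monoid M)"
  shows "right_FP_infty M"
proof -
  have "carrier (monoid_ring (opposite_monoid M)) = carrier (monoid_ring M)"
    by (simp add: monoid_ring_sel)
  from fg_free_resolution_carrier_cong[OF this] assms(2) right_module_opposite[OF assms(1)]
  show ?thesis unfolding left_FP_infty_def right_FP_infty_def by fast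
qed

context quadratic_system
begin

lemma ev_opposite: "w \<in> lists G \<Longrightarrow> monoid_eval (opposite_monoid M) gen w = ev (rev w)"
proof (induction w)
  case (Cons a w)
  have "rev w \<in> lists G" "[a] \<in> lists G" using Cons by auto
  from ev_append[OF this] show ?case using Cons by (simp add: monoid_eval_def gen_closed)
qed (simp add: monoid_eval_def)

text \<open>Reversal maps pairs to pairs and normal words to normal words, and
  \<open>val_mono\<close> is already two-sided.\<close>

lemma quadratic_system_opposite:
  "quadratic_system (opposite_monoid M) G gen (\<lambda>a b. good b a) (\<lambda>w. val (rev w))"
proof (intro quadratic_system.intro quadratic_system_axioms.intro monoid_opposite_monoid monoid_axioms)
  have rev: "rev w \<in> lists G" if "w \<in> lists G" for w using that by auto
  show "\<exists>w\<in>lists G. monoid_eval (opposite_monoid M) gen w = m" if m: "m \<in> carrier (opposite_monoid M)" for m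
  proof -
    obtain w where "w \<in> lists G" "ev w = m" using m generates by auto
    then show ?thesis using rev[of w] ev_opposite[OF rev, of w] by (intro bexI[of _ "rev w"]) auto
  qed
  show "\<exists>v\<in>lists G. monoid_eval (opposite_monoid M) gen v = monoid_eval (opposite_monoid M) gen [a, b] \<and>
      val (rev v) < val (rev [a, b])" if ab: "a \<in> G" "b \<in> G" "\<not> good b a" for a b
  proof -
    obtain v where v: "v \<in> lists G" "ev v = ev [b, a]" "val v < val [b, a]"
      using reduce_pair[of b a] ab by blast
    have "[a, b] \<in> lists G" using ab by simp
    then show ?thesis using v rev[of v] ev_opposite[OF rev, of v] ev_opposite[of "[a, b]"]
      by (intro bexI[of _ "rev v"]) auto
  qed
  show "u = v" if "u \<in> lists G" "v \<in> lists G" "successively (\<lambda>a b. good b a) u" "successively (\<lambda>a b. good b a) v"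
    "monoid_eval (opposite_monoid M) gen u = monoid_eval (opposite_monoid M) gen v" for u v
    using unique_normal[of "rev u" "rev v"] that rev by (simp add: ev_opposite successively_rev)
  show "val (rev (x @ u @ y)) < val (rev (x @ v @ y))"
    if "u \<in> lists G" "v \<in> lists G" "x \<in> lists G" "y \<in> lists G" "val (rev u) < val (rev v)" for u v x y
    using val_mono[OF rev rev rev rev, of u v y x] that by simp
qed (use finite_gens gen_closed val_Nil in auto)

theorem right_FP_infty: "right_FP_infty M"
  by (rule right_FP_infty_opposite[OF monoid_axioms quadratic_system.left_FP_infty[OF quadratic_system_opposite]])

end

section \<open>The Plactic monoid\<close>

text \<open>The empty column is left out: it evaluates to the unit, so normal forms would not be
  unique with it.\<close>

definition columns :: "nat \<Rightarrow> nat set set" where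
  "columns n = Pow {1..n} - {{}}"

text \<open>Words of columns are compared by length first and then lexicographically, longer columns
  being smaller. Reading the numbers \<open>n + 1 - card C \<in> {1..n}\<close> as digits in base \<open>n + 1\<close> encodes
  this order.\<close>

fun column_val :: "nat \<Rightarrow> nat set list \<Rightarrow> nat" where
  "column_val n [] = 0"
| "column_val n (C # w) = (n + 1 - card C) * (n + 1) ^ length w + column_val n w"

lemma columns_simps:
  assumes "C \<in> columns n"
  shows "finite C" "C \<noteq> {}" "C \<subseteq> {1..n}" "card C \<le> n" "0 < card C"
proof -
  show "C \<noteq> {}" "C \<subseteq> {1..n}" using assms by (auto simp: columns_def)
  then show "finite C" using finite_subset by blast
  then show "0 < card C" using \<open>C \<noteq> {}\<close> by (simp add: card_gt_0_iff)
  show "card C \<le> n" using card_mono[OF _ \<open>C \<subseteq> {1..n}\<close>] by simp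
qed

lemma column_word_columns: "C \<in> columns n \<Longrightarrow> column_word C \<in> lists {1..n}"
  by (rule column_word_lists[OF columns_simps(1,3)])

lemma column_val_less: "w \<in> lists (columns n) \<Longrightarrow> column_val n w < (n + 1) ^ length w"
proof (induction w)
  case (Cons C w)
  have "n + 1 - card C \<le> n" using Cons.prems columns_simps(5)[of C n] by simp
  then have "(n + 1 - card C) * (n + 1) ^ length w \<le> n * (n + 1) ^ length w" by (rule mult_right_mono) simp
  moreover have "column_val n w < (n + 1) ^ length w" using Cons by simp
  ultimately have "column_val n (C # w) < n * (n + 1) ^ length w + (n + 1) ^ length w"
    unfolding column_val.simps by (rule add_le_less_mono)
  then show ?case by (simp add: algebra_simps)
qed simp

lemma column_val_append: "column_val n (u @ v) = column_val n u * (n + 1) ^ length v + column_val n v"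
  by (induction u) (simp_all add: power_add algebra_simps del: power_Suc)

lemma column_val_mono:
  assumes "u \<in> lists (columns n)" "v \<in> lists (columns n)" "column_val n u < column_val n v"
    and y: "y \<in> lists (columns n)"
  shows "column_val n (x @ u @ y) < column_val n (x @ v @ y)"
proof -
  have len: "length u \<le> length v"
  proof (rule ccontr)
    assume less: "\<not> length u \<le> length v"
    then obtain C w where u: "u = C # w" by (cases u) auto
    \<comment> \<open>The leading digit is not 0, as a column has at most n entries; so a longer
      word has a larger value than any shorter one.\<close>
    have "1 \<le> n + 1 - card C" using columns_simps(4)[of C n] assms(1) u by simp
    have "(n + 1) ^ length v \<le> 1 * (n + 1) ^ length w"
      unfolding mult_1 using less u by (intro power_increasing) auto
    also have "\<dots> \<le> (n + 1 - card C) * (n + 1) ^ length w"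
      by (rule mult_right_mono[OF \<open>1 \<le> n + 1 - card C\<close>]) simp
    also have "\<dots> \<le> column_val n u" by (simp add: u)
    finally have "(n + 1) ^ length v \<le> column_val n u" .
    then show False using column_val_less[OF assms(2)] assms(3) by simp
  qed
  have "column_val n x * (n + 1) ^ (length u + length y) \<le> column_val n x * (n + 1) ^ (length v + length y)"
    using len by (intro mult_left_mono power_increasing) auto
  moreover have "column_val n u * (n + 1) ^ length y < column_val n v * (n + 1) ^ length y"
    using assms(3) by simp
  ultimately show ?thesis unfolding column_val_append length_append by linarith
qed

definition column_class :: "nat \<Rightarrow> nat set \<Rightarrow> nat list set" where
  "column_class n C = plactic_cong n `` {column_word C}"

lemma columns_word_lists: "w \<in> lists (columns n) \<Longrightarrow> columns_word w \<in> lists {1..n}"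
proof (induction w)
  case (Cons C w)
  then have "column_word C \<in> lists {1..n}" "columns_word w \<in> lists {1..n}"
    using column_word_columns by simp_all
  then show ?case by simp
qed simp

lemma plactic_eval:
  "w \<in> lists (columns n) \<Longrightarrow>
    monoid_eval (plactic_monoid n) (column_class n) w = plactic_cong n `` {columns_word w}"
proof (induction w)
  case Nil
  then show ?case by (simp add: monoid_eval_def plactic_monoid_def presented_monoid_def)
next
  case (Cons C w)
  then have "column_word C \<in> lists {1..n}" "columns_word w \<in> lists {1..n}"
    using column_word_columns columns_word_lists by simp_all
  from presented_monoid_mult_class[OF plactic_rels_lists this] Cons show ?case
    by (simp add: monoid_eval_def plactic_monoid_def column_class_def)
qed

lemma plactic_eval_eq_iff:
  assumes "u \<in> lists (columns n)" "v \<in> lists (columns n)"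
  shows "monoid_eval (plactic_monoid n) (column_class n) u = monoid_eval (plactic_monoid n) (column_class n) v \<longleftrightarrow>
    (columns_word u, columns_word v) \<in> plactic_cong n"
  unfolding plactic_eval[OF assms(1)] plactic_eval[OF assms(2)]
  by (rule eq_equiv_class_iff[OF equiv_pres_cong[OF plactic_rels_lists]]) (use assms columns_word_lists in auto)

lemma quadratic_system_plactic:
  "quadratic_system (plactic_monoid n) (columns n) (column_class n) tableau_pair (column_val n)"
proof (intro quadratic_system.intro quadratic_system_axioms.intro monoid_plactic_monoid)
  show "finite (columns n)" by (simp add: columns_def)
  show "column_class n C \<in> carrier (plactic_monoid n)" if "C \<in> columns n" for C
  proof -
    have "column_word C \<in> lists {1..n}" using that by (rule column_word_columns)
    then show ?thesis
      by (simp add: column_class_def plactic_monoid_def presented_monoid_def quotientI del: in_lists_conv_set)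
  qed
  show "\<exists>w\<in>lists (columns n). monoid_eval (plactic_monoid n) (column_class n) w = m"
    if m: "m \<in> carrier (plactic_monoid n)" for m
  proof -
    obtain u where u: "u \<in> lists {1..n}" "m = plactic_cong n `` {u}"
      using m by (auto simp: plactic_monoid_def presented_monoid_def elim!: quotientE)
    \<comment> \<open>Letters are columns of height 1, so the columns generate.\<close>
    have "column_word {a} = [a]" for a by (rule column_word_eqI) auto
    then have "columns_word (map (\<lambda>a. {a}) u) = u" by (induction u) auto
    moreover have "map (\<lambda>a. {a}) u \<in> lists (columns n)" using u(1) by (auto simp: columns_def)
    ultimately show ?thesis using plactic_eval u(2) by metis
  qed
  show "u = v" if "u \<in> lists (columns n)" "v \<in> lists (columns n)" "successively tableau_pair u"
    "successively tableau_pair v"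
    "monoid_eval (plactic_monoid n) (column_class n) u = monoid_eval (plactic_monoid n) (column_class n) v" for u v
  proof (rule tableau_unique[of u v n])
    show "(columns_word u, columns_word v) \<in> plactic_cong n" using that by (simp add: plactic_eval_eq_iff)
    show "\<forall>C\<in>set u. finite C \<and> C \<noteq> {}" "\<forall>C\<in>set v. finite C \<and> C \<noteq> {}"
      using that(1,2) columns_simps(1,2)[where n = n] by blast+
  qed fact+
  show "\<exists>v\<in>lists (columns n).
      monoid_eval (plactic_monoid n) (column_class n) v = monoid_eval (plactic_monoid n) (column_class n) [C, D] \<and>
      column_val n v < column_val n [C, D]"
    if CD: "C \<in> columns n" "D \<in> columns n" "\<not> tableau_pair C D" for C D
  proof -
    note C = columns_simps[OF CD(1)] and D = columns_simps[OF CD(2)]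
    define E where "E = word_col (column_word C) D"
    define F where "F = set (word_out (column_word C) D)"
    note ins = insert_column[OF C(1) D(1) CD(3), folded E_def F_def]
    have E: "E \<in> columns n" using ins(3,4) C(3) D(3) by (auto simp: columns_def)
    have lC: "column_word C \<in> lists {1..n}" by (rule column_word_columns[OF CD(1)])
    have cong: "(column_word C @ column_word D, column_word E @ column_word F) \<in> plactic_cong n"
      using insert_word_cong[OF lC D(3)] by (simp add: ins(1) E_def)
    \<comment> \<open>A longer first column lowers the leading digit by at least 1, which is worth n
      + 1, while the last digit is at most n. So the value drops whatever F is.\<close>
    have small: "n + 1 - card E + 1 \<le> n + 1 - card C"
      using ins(3) columns_simps(4)[OF E] by simp
    have "(n + 1 - card E + 1) * (n + 1) \<le> (n + 1 - card C) * (n + 1)"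
      by (rule mult_right_mono[OF small]) simp
    then have less: "(n + 1 - card E) * (n + 1) + n < column_val n [C, D]"
      using D(4) by simp
    show ?thesis
    proof (cases "F = {}")
      case True
      \<comment> \<open>With nothing bumped, the product is the single column E, since the empty
        column is not a generator.\<close>
      have "column_val n [E] \<le> n" using columns_simps(5)[OF E] by simp
      also have "\<dots> < column_val n [C, D]" using less by linarith
      finally show ?thesis
        using E CD cong True by (intro bexI[of _ "[E]"]) (simp_all add: plactic_eval_eq_iff pres_cong.sym)
    next
      case False
      then have F: "F \<in> columns n" using ins(2) D(3) by (auto simp: columns_def)
      have "column_val n [E, F] \<le> (n + 1 - card E) * (n + 1) + n" using columns_simps(5)[OF F] by simp
      then have "column_val n [E, F] < column_val n [C, D]" using less by linarith
      then show ?thesis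
        using E F CD cong by (intro bexI[of _ "[E, F]"]) (simp_all add: plactic_eval_eq_iff pres_cong.sym del: column_val.simps)
    qed
  qed
  show "column_val n (x @ u @ y) < column_val n (x @ v @ y)"
    if "u \<in> lists (columns n)" "v \<in> lists (columns n)" "x \<in> lists (columns n)" "y \<in> lists (columns n)"
      "column_val n u < column_val n v" for u v x y
    using column_val_mono that by blast
  show "column_val n [] < column_val n [C]" if "C \<in> columns n" for C
    using columns_simps(4)[OF that] by simp
qed

theorem corollary3p6:
  fixes n :: nat
  assumes "1 \<le> n"
  shows "right_FP_infty (plactic_monoid n) \<and> left_FP_infty (plactic_monoid n)"
  using quadratic_system.right_FP_infty[OF quadratic_system_plactic]
    quadratic_system.left_FP_infty[OF quadratic_system_plactic] by blast

end
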